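(* $\mathrm{ZL}^1(\mathrm{SU}(2))$ is not amenable.
   Context: $\mathrm{ZL}^1(G)$ denotes the centre of the convolution algebra $\mathrm{L}^1(G)$ of a compact group $G$ (normalised Haar measure). A Banach algebra $\mathfrak{A}$ is amenable if it has a bounded approximate diagonal: a bounded net $(\mu_\alpha)$ in $\mathfrak{A}\hat\otimes\mathfrak{A}$ with $m(\mu_\alpha)a\to a$, $a\,m(\mu_\alpha)\to a$, $a\cdot\mu_\alpha-\mu_\alpha\cdot a\to0$ for all $a$ ($m$ multiplication, $a\cdot(b\otimes c)=ab\otimes c$, $(b\otimes c)\cdot a=b\otimes ca$). *)

theory Defs
  imports "HOL-Analysis.Analysis"
begin

type_synonym mat2 = "complex^2^2"
type_synonym fn = "mat2 \<Rightarrow> complex"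

definition ctrans :: "mat2 \<Rightarrow> mat2" where
  "ctrans U = (\<chi> i j. cnj (U $ j $ i))"

definition SU2 :: "mat2 set" where
  "SU2 = {U. U ** ctrans U = mat 1 \<and> det U = 1}"

definition haar_SU2 :: "mat2 measure \<Rightarrow> bool" where
  "haar_SU2 M \<longleftrightarrow>
     space M = SU2 \<and> sets M = sets (restrict_space borel SU2) \<and>
     emeasure M (space M) = 1 \<and>
     (\<forall>g\<in>SU2. \<forall>A\<in>sets M. emeasure M ((\<lambda>x. g ** x) ` A) = emeasure M A)"

definition L1norm :: "mat2 measure \<Rightarrow> fn \<Rightarrow> real" where
  "L1norm M f = (\<integral>x. norm (f x) \<partial>M)"

definition conv :: "mat2 measure \<Rightarrow> fn \<Rightarrow> fn \<Rightarrow> fn" where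
  "conv M f g = (\<lambda>x. \<integral>y. f y * g (ctrans y ** x) \<partial>M)"

text \<open>Representatives of elements of the centre ZL1(G) of the convolution algebra L1(G):
  integrable functions commuting (a.e.) under convolution with every integrable function.\<close>
definition ZL1 :: "mat2 measure \<Rightarrow> fn set" where
  "ZL1 M = {f. integrable M f \<and>
     (\<forall>g. integrable M g \<longrightarrow> (AE x in M. conv M f g x = conv M g f x))}"

text \<open>Bounded bilinear forms of norm at most 1 on ZL1 (these are the unit ball of the dual of
  the projective tensor product ZL1 \<otimes> ZL1).\<close>
definition bilin1 :: "mat2 measure \<Rightarrow> (fn \<Rightarrow> fn \<Rightarrow> complex) set" where
  "bilin1 M = {B.
     (\<forall>f1\<in>ZL1 M. \<forall>f2\<in>ZL1 M. \<forall>g\<in>ZL1 M.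
         B (\<lambda>x. f1 x + f2 x) g = B f1 g + B f2 g \<and> B g (\<lambda>x. f1 x + f2 x) = B g f1 + B g f2) \<and>
     (\<forall>c. \<forall>f\<in>ZL1 M. \<forall>g\<in>ZL1 M. B (\<lambda>x. c * f x) g = c * B f g \<and> B g (\<lambda>x. c * f x) = c * B g f) \<and>
     (\<forall>f\<in>ZL1 M. \<forall>g\<in>ZL1 M. norm (B f g) \<le> L1norm M f * L1norm M g)}"

text \<open>Projective tensor norm of an element of ZL1 \<otimes> ZL1, given through its pairing
  with bilinear forms (duality).\<close>
definition proj_norm :: "mat2 measure \<Rightarrow> ((fn \<Rightarrow> fn \<Rightarrow> complex) \<Rightarrow> complex) \<Rightarrow> real" where
  "proj_norm M \<Phi> = (SUP B\<in>bilin1 M. norm (\<Phi> B))"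

text \<open>A bounded net (indexed along the filter F) in ZL1 \<otimes> ZL1, the element at index i being
  the absolutely convergent series \<Sum>n u i n \<otimes> v i n, with w i = m(\<mu>_i) (L1-limit of
  \<Sum>n u i n * v i n), which is a bounded approximate diagonal.\<close>
definition bounded_approx_diagonal ::
  "mat2 measure \<Rightarrow> 'i filter \<Rightarrow> ('i \<Rightarrow> nat \<Rightarrow> fn) \<Rightarrow> ('i \<Rightarrow> nat \<Rightarrow> fn) \<Rightarrow> ('i \<Rightarrow> fn) \<Rightarrow> bool"
where
  "bounded_approx_diagonal M F u v w \<longleftrightarrow>
     (\<forall>i n. u i n \<in> ZL1 M \<and> v i n \<in> ZL1 M) \<and>
     (\<exists>C. \<forall>i. summable (\<lambda>n. L1norm M (u i n) * L1norm M (v i n)) \<and>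
              (\<Sum>n. L1norm M (u i n) * L1norm M (v i n)) \<le> C) \<and>
     (\<forall>i. w i \<in> ZL1 M \<and>
          (\<lambda>N. L1norm M (\<lambda>x. (\<Sum>n<N. conv M (u i n) (v i n) x) - w i x)) \<longlonglongrightarrow> 0) \<and>
     (\<forall>a\<in>ZL1 M.
        ((\<lambda>i. L1norm M (\<lambda>x. conv M (w i) a x - a x)) \<longlongrightarrow> 0) F \<and>
        ((\<lambda>i. L1norm M (\<lambda>x. conv M a (w i) x - a x)) \<longlongrightarrow> 0) F \<and>
        ((\<lambda>i. proj_norm M (\<lambda>B. (\<Sum>n. B (conv M a (u i n)) (v i n))
                                 - (\<Sum>n. B (u i n) (conv M (v i n) a)))) \<longlongrightarrow> 0) F)"

end

theory Submission
  imports Defs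
begin

text \<open>
  Let \<open>p\<^sub>k\<close> be the normalised character of the irreducible representation of dimension \<open>3 ^ k\<close>; then
  \<open>f \<mapsto> \<integral> f p\<^sub>k\<close> is multiplicative on the centre. A bounded approximate diagonal, paired with
  \<open>p\<^sub>k \<otimes> p\<^sub>l\<close>, tends to \<open>1\<close> if \<open>k = l\<close> and to \<open>0\<close> otherwise. Hence, with
  \<open>\<psi>\<^sub>k = p\<^sub>k - p\<^bsub>k+1\<^esub>\<close>, its pairing with \<open>\<Sum>k<K. \<psi>\<^sub>k \<otimes> \<psi>\<^sub>k\<close> tends to \<open>2 * K\<close>. But tripling the angle
  gives \<open>\<psi>\<^sub>k = (4/3) sin\<^sup>2 (3 ^ k * \<theta>) p\<^sub>k\<close>, from which \<open>\<psi>\<^sub>k\<^sup>2 \<le> 2 * (p\<^sub>k\<^sup>2 - p\<^bsub>k+1\<^esub>\<^sup>2)\<close>; the squares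
  telescope, so by Cauchy-Schwarz these bilinear forms have norm at most \<open>2\<close> for all \<open>K\<close>.
\<close>

text \<open>Why powers of three: passing from dimension \<open>n\<close> to \<open>2 * n\<close>
  multiplies the normalised character by \<open>r = cos (n * \<theta>)\<close>, which reaches -1,
  and near \<open>r = -1\<close> no constant \<open>c\<close> gives
  \<open>(1 - r)^2 <= c * (1 - r^2)\<close>. Tripling gives a factor \<open>r >= -1/3\<close>, and 2
  is exactly the constant that this bound allows. Odd dimensions also make the characters even
  functions of the cosine. Multiplicativity is obtained without representation theory, from the
  functional equation \<open>p (y) * p (x) = (average over c of p (c y c^-1 x))\<close>. By
  invariance alone, the cosine of \<open>c y c^-1 x\<close> has the moments of a uniform law on an
  interval, and the character is, up to a factor, the derivative of a Chebyshev polynomial, so that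
  the average is a difference of two cosines. The test form contains only the pairs
  \<open>(k, k)\<close>, \<open>(k, k+1)\<close> and \<open>(k+1, k)\<close>, so it is enough to
  find a central element on which two neighbouring characters differ, and \<open>psi k\<close> is
  one.\<close>

lemma continuous_on_matrix_mult [continuous_intros]:
  fixes f g :: "'a::topological_space \<Rightarrow> mat2"
  assumes "continuous_on S f" "continuous_on S g"
  shows "continuous_on S (\<lambda>x. f x ** g x)"
  unfolding matrix_matrix_mult_def
  by (intro continuous_on_vec_lambda continuous_on_sum continuous_on_mult continuous_on_component assms)

lemma continuous_on_ctrans [continuous_intros]:
  fixes f :: "'a::topological_space \<Rightarrow> mat2"
  assumes "continuous_on S f"
  shows "continuous_on S (\<lambda>x. ctrans (f x))"
  unfolding ctrans_def
  by (intro continuous_on_vec_lambda continuous_on_cnj continuous_on_component assms)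

section \<open>Algebra of SU(2)\<close>

lemma ctrans_mult: "ctrans (U ** V) = ctrans V ** ctrans U"
  by (simp add: ctrans_def matrix_matrix_mult_def vec_eq_iff mult.commute)

lemma ctrans_ctrans [simp]: "ctrans (ctrans U) = U"
  by (simp add: ctrans_def vec_eq_iff)

lemma det_ctrans: "det (ctrans U) = cnj (det U)"
  by (simp add: det_2 ctrans_def mult.commute)

lemma SU2_mult_ctrans: "U \<in> SU2 \<Longrightarrow> U ** ctrans U = mat 1"
  by (simp add: SU2_def)

lemma SU2_ctrans_mult: "U \<in> SU2 \<Longrightarrow> ctrans U ** U = mat 1"
  using SU2_mult_ctrans matrix_left_right_inverse by blast

lemma SU2_ctrans [simp]: "U \<in> SU2 \<Longrightarrow> ctrans U \<in> SU2"
  using SU2_ctrans_mult[of U] by (simp add: SU2_def det_ctrans)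

lemma SU2_mult [simp]: "U \<in> SU2 \<Longrightarrow> V \<in> SU2 \<Longrightarrow> U ** V \<in> SU2"
  unfolding SU2_def
  by (simp add: ctrans_mult det_mul) (metis matrix_mul_assoc matrix_mul_rid)

lemma SU2_one: "mat 1 \<in> SU2"
  by (simp add: SU2_def ctrans_def vec_eq_iff matrix_matrix_mult_def mat_def sum_2 forall_2 det_2)

lemma SU2_cancel:
  assumes "U \<in> SU2"
  shows "U ** (ctrans U ** V) = V" "ctrans U ** (U ** V) = V"
        "(V ** U) ** ctrans U = V" "(V ** ctrans U) ** U = V"
  using SU2_mult_ctrans[OF assms] SU2_ctrans_mult[OF assms]
  by (simp_all add: matrix_mul_assoc) (simp_all flip: matrix_mul_assoc)

text \<open>The second row is orthogonal to the first, hence a multiple of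
  \<open>(- cnj b, cnj a)\<close>; the determinant fixes the factor as 1.\<close>

lemma SU2_entries:
  assumes "U \<in> SU2"
  shows "U $ 2 $ 2 = cnj (U $ 1 $ 1)" "U $ 2 $ 1 = - cnj (U $ 1 $ 2)"
    "U $ 1 $ 1 * cnj (U $ 1 $ 1) + U $ 1 $ 2 * cnj (U $ 1 $ 2) = 1"
proof -
  define a b c d where abcd: "a = U $ 1 $ 1" "b = U $ 1 $ 2" "c = U $ 2 $ 1" "d = U $ 2 $ 2"
  have "U ** ctrans U = mat 1" and det: "a * d - b * c = 1"
    using assms by (auto simp: SU2_def det_2 abcd)
  then have e: "a * cnj a + b * cnj b = 1" "a * cnj c + b * cnj d = 0"
    unfolding abcd by (auto simp: vec_eq_iff matrix_matrix_mult_def ctrans_def mat_def sum_2 forall_2)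
  have e3: "cnj a * c + cnj b * d = 0"
    using arg_cong[OF e(2), of cnj] by simp
  have "d = cnj a" using det e(1) e3 by algebra
  moreover have "c = - cnj b" using det e(1) e3 by algebra
  ultimately show "U $ 2 $ 2 = cnj (U $ 1 $ 1)" "U $ 2 $ 1 = - cnj (U $ 1 $ 2)"
    "U $ 1 $ 1 * cnj (U $ 1 $ 1) + U $ 1 $ 2 * cnj (U $ 1 $ 2) = 1"
    using e by (simp_all add: abcd)
qed

subsection \<open>Invariance of Haar measure\<close>

locale haar =
  fixes M :: "mat2 measure"
  assumes haar: "haar_SU2 M"
begin

lemma space_M [simp]: "space M = SU2"
  and sets_M: "sets M = sets (restrict_space borel SU2)"
  and emeasure_space_1: "emeasure M SU2 = 1"
  and emeasure_translate: "g \<in> SU2 \<Longrightarrow> A \<in> sets M \<Longrightarrow> emeasure M ((\<lambda>x. g ** x) ` A) = emeasure M A"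
  using haar by (auto simp: haar_SU2_def)

sublocale finite_measure M
  by standard (simp add: emeasure_space_1)

sublocale pair_sigma_finite M M ..

lemma measure_SU2 [simp]: "measure M SU2 = 1"
  by (simp add: measure_def emeasure_space_1)

lemma measurable_M_iff: "f \<in> measurable N M \<longleftrightarrow> f \<in> measurable N borel \<and> f \<in> space N \<rightarrow> SU2"
  by (subst measurable_cong_sets[OF refl sets_M]) (auto simp: measurable_restrict_space2_iff)

lemma id_borel [measurable]: "(\<lambda>x. x) \<in> borel_measurable M"
  using measurable_M_iff[of "\<lambda>x. x" M] by simp

lemma borel_measurable_continuous [measurable (raw)]:
  "continuous_on UNIV f \<Longrightarrow> f \<in> borel_measurable M"
  using measurable_compose[OF id_borel borel_measurable_continuous_onI] by blast

lemma mult_measurable [measurable]: "(\<lambda>p. fst p ** snd p) \<in> measurable (M \<Otimes>\<^sub>M M) M"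
proof -
  have "(\<lambda>p::mat2\<times>mat2. fst p ** snd p) \<in> borel_measurable borel"
    by (intro borel_measurable_continuous_onI continuous_intros)
  then have "(\<lambda>p::mat2\<times>mat2. fst p ** snd p) \<in> borel_measurable (borel \<Otimes>\<^sub>M borel)"
    by (simp add: borel_prod)
  moreover have "(\<lambda>p. (fst p, snd p)) \<in> measurable (M \<Otimes>\<^sub>M M) (borel \<Otimes>\<^sub>M borel)"
    by measurable
  ultimately have "(\<lambda>p. fst p ** snd p) \<in> borel_measurable (M \<Otimes>\<^sub>M M)"
    using measurable_compose by force
  then show ?thesis
    by (auto simp: measurable_M_iff space_pair_measure)
qed

lemma measurable_mult [measurable (raw)]:
  "f \<in> measurable N M \<Longrightarrow> g \<in> measurable N M \<Longrightarrow> (\<lambda>x. f x ** g x) \<in> measurable N M"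
  using measurable_compose[OF measurable_Pair mult_measurable, of f N g] by simp

lemma measurable_left: "g \<in> SU2 \<Longrightarrow> (\<lambda>x. g ** x) \<in> measurable M M"
  and measurable_right: "g \<in> SU2 \<Longrightarrow> (\<lambda>x. x ** g) \<in> measurable M M"
  by (intro measurable_mult; simp)+

lemma ctrans_measurable [measurable]: "ctrans \<in> measurable M M"
  by (auto simp: measurable_M_iff intro!: borel_measurable_continuous continuous_intros)

lemma distr_left:
  assumes g: "g \<in> SU2"
  shows "distr M M (\<lambda>x. g ** x) = M"
proof (rule measure_eqI)
  fix A assume "A \<in> sets (distr M M (\<lambda>x. g ** x))"
  then have A [measurable]: "A \<in> sets M" by simp
  have sub: "A \<subseteq> SU2" using sets.sets_into_space[OF A] by simp
  have [measurable]: "(\<lambda>x. g ** x) \<in> measurable M M" using g by (simp add: measurable_left)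
  have "(\<lambda>x. g ** x) -` A \<inter> space M = (\<lambda>x. ctrans g ** x) ` A"
  proof safe
    fix x assume "g ** x \<in> A" then show "x \<in> (\<lambda>x. ctrans g ** x) ` A"
      using SU2_cancel(2)[OF g, of x] by (metis imageI)
  qed (use g sub in \<open>auto simp: SU2_cancel\<close>)
  then show "emeasure (distr M M (\<lambda>x. g ** x)) A = emeasure M A"
    using emeasure_translate[of "ctrans g" A] g by (simp add: emeasure_distr)
qed simp

lemma nn_integral_left:
  assumes "g \<in> SU2" "f \<in> borel_measurable M"
  shows "(\<integral>\<^sup>+x. f (g ** x) \<partial>M) = (\<integral>\<^sup>+x. f x \<partial>M)"
proof -
  have [measurable]: "(\<lambda>x. g ** x) \<in> measurable M M" using assms(1) by (rule measurable_left)
  show ?thesis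
    by (subst (2) distr_left[OF assms(1), symmetric]) (use assms(2) in \<open>simp add: nn_integral_distr\<close>)
qed

text \<open>Average the left translates by \<open>ctrans x\<close> over \<open>x\<close> and swap the
  integrals, so that \<open>ctrans x ** y = ctrans (ctrans y ** x)\<close> becomes a left translate in \<open>x\<close>.\<close>

lemma nn_integral_ctrans:
  assumes [measurable]: "f \<in> borel_measurable M"
  shows "(\<integral>\<^sup>+x. f (ctrans x) \<partial>M) = (\<integral>\<^sup>+x. f x \<partial>M)"
proof -
  have "(\<integral>\<^sup>+x. f x \<partial>M) = (\<integral>\<^sup>+x. (\<integral>\<^sup>+y. f (ctrans x ** y) \<partial>M) \<partial>M)"
    by (subst nn_integral_cong[where v = "\<lambda>x. \<integral>\<^sup>+y. f y \<partial>M"])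
       (auto simp: nn_integral_left emeasure_space_1)
  also have "\<dots> = (\<integral>\<^sup>+y. (\<integral>\<^sup>+x. f (ctrans x ** y) \<partial>M) \<partial>M)"
    by (intro Fubini') simp
  also have "\<dots> = (\<integral>\<^sup>+y. (\<integral>\<^sup>+x. f (ctrans (ctrans y ** x)) \<partial>M) \<partial>M)"
    by (simp add: ctrans_mult)
  also have "\<dots> = (\<integral>\<^sup>+y. (\<integral>\<^sup>+x. f (ctrans x) \<partial>M) \<partial>M)"
    by (intro nn_integral_cong nn_integral_left[of _ "\<lambda>x. f (ctrans x)"]) auto
  finally show ?thesis by (simp add: emeasure_space_1)
qed

lemma distr_ctrans: "distr M M ctrans = M"
proof (rule measure_eqI)
  fix A assume "A \<in> sets (distr M M ctrans)"
  then have A [measurable]: "A \<in> sets M" by simp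
  have "emeasure (distr M M ctrans) A = (\<integral>\<^sup>+x. indicator A (ctrans x) \<partial>M)"
    using nn_integral_indicator[of A "distr M M ctrans"]
    by (simp add: nn_integral_distr del: nn_integral_indicator)
  then show "emeasure (distr M M ctrans) A = emeasure M A"
    by (simp add: nn_integral_ctrans)
qed simp

text \<open>Right translation by \<open>g\<close> is inversion, then left translation by
  \<open>ctrans g\<close>, then inversion again. \<open>haar_SU2\<close> postulates left invariance
  only, so invariance under inversion has to come first.\<close>

lemma distr_right:
  assumes g: "g \<in> SU2"
  shows "distr M M (\<lambda>x. x ** g) = M"
proof -
  have [measurable]: "(\<lambda>x. ctrans g ** x) \<in> measurable M M" using g by (simp add: measurable_left)
  have "M = distr (distr (distr M M ctrans) M (\<lambda>x. ctrans g ** x)) M ctrans"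
    using g by (simp add: distr_left distr_ctrans)
  also have "\<dots> = distr M M (\<lambda>x. x ** g)"
    by (subst distr_distr, simp, simp, subst distr_distr) (auto simp: comp_def ctrans_mult)
  finally show ?thesis by simp
qed

lemma integral_left:
  fixes f :: "mat2 \<Rightarrow> 'b::{banach,second_countable_topology}"
  assumes "g \<in> SU2" "f \<in> borel_measurable M"
  shows "(\<integral>x. f (g ** x) \<partial>M) = (\<integral>x. f x \<partial>M)"
proof -
  have "(\<lambda>x. g ** x) \<in> measurable M M" using assms(1) by (rule measurable_left)
  then show ?thesis
    by (subst (2) distr_left[OF assms(1), symmetric]) (use assms(2) in \<open>simp add: integral_distr\<close>)
qed

lemma integral_right:
  fixes f :: "mat2 \<Rightarrow> 'b::{banach,second_countable_topology}"
  assumes "g \<in> SU2" "f \<in> borel_measurable M"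
  shows "(\<integral>x. f (x ** g) \<partial>M) = (\<integral>x. f x \<partial>M)"
proof -
  have "(\<lambda>x. x ** g) \<in> measurable M M" using assms(1) by (rule measurable_right)
  then show ?thesis
    by (subst (2) distr_right[OF assms(1), symmetric]) (use assms(2) in \<open>simp add: integral_distr\<close>)
qed

lemma integral_ctrans:
  fixes f :: "mat2 \<Rightarrow> 'b::{banach,second_countable_topology}"
  assumes "f \<in> borel_measurable M"
  shows "(\<integral>x. f (ctrans x) \<partial>M) = (\<integral>x. f x \<partial>M)"
  by (subst (2) distr_ctrans[symmetric]) (use assms in \<open>simp add: integral_distr\<close>)

lemma integrable_left:
  fixes f :: "mat2 \<Rightarrow> 'b::{banach,second_countable_topology}"
  assumes "g \<in> SU2" "integrable M f"
  shows "integrable M (\<lambda>x. f (g ** x))"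
proof -
  have "(\<lambda>x. g ** x) \<in> measurable M M" using assms(1) by (rule measurable_left)
  then show ?thesis
    using integrable_distr[of "\<lambda>x. g ** x" M M f] assms by (simp add: distr_left)
qed

end

subsection \<open>Convolution and the centre\<close>

lemma norm_mult_le_bound:
  "norm b \<le> C \<Longrightarrow> norm (a * b) \<le> C * norm (a :: 'a::real_normed_div_algebra)"
  by (simp add: norm_mult mult.commute[of "norm a"] mult_right_mono)

context haar
begin

text \<open>Test functions in the role of the dual of L1. The bound holds everywhere on
  \<open>SU2\<close> and not just almost everywhere, so that all translates obey it without null
  sets; values off \<open>SU2\<close> are free, as \<open>space M = SU2\<close>.\<close>

definition bmeas :: "fn set" where
  "bmeas = {q \<in> borel_measurable M. \<exists>C. \<forall>x\<in>SU2. norm (q x) \<le> C}"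

lemma bmeas_measurable: "q \<in> bmeas \<Longrightarrow> q \<in> borel_measurable M"
  by (simp add: bmeas_def)

lemma bmeas_bound:
  assumes "q \<in> bmeas" obtains C where "C \<ge> 0" "\<And>x. x \<in> SU2 \<Longrightarrow> norm (q x) \<le> C"
proof -
  obtain C where "\<forall>x\<in>SU2. norm (q x) \<le> C" using assms by (auto simp: bmeas_def)
  then show ?thesis using that[of "max C 0"] by fastforce
qed

lemma bmeasI: "q \<in> borel_measurable M \<Longrightarrow> (\<And>x. x \<in> SU2 \<Longrightarrow> norm (q x) \<le> C) \<Longrightarrow> q \<in> bmeas"
  by (auto simp: bmeas_def)

lemma bmeas_left:
  assumes q: "q \<in> bmeas" and g: "g \<in> SU2"
  shows "(\<lambda>x. q (g ** x)) \<in> bmeas"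
proof -
  obtain C where "\<And>x. x \<in> SU2 \<Longrightarrow> norm (q x) \<le> C" using bmeas_bound[OF q] by blast
  then show ?thesis
    using measurable_compose[OF measurable_left[OF g] bmeas_measurable[OF q]] g
    by (intro bmeasI[of _ C]) auto
qed

lemma integrable_mult_bmeas:
  fixes f :: fn
  assumes "integrable M f" "q \<in> bmeas"
  shows "integrable M (\<lambda>x. f x * q x)"
proof -
  obtain C where C: "C \<ge> 0" "\<And>x. x \<in> SU2 \<Longrightarrow> norm (q x) \<le> C" using bmeas_bound[OF assms(2)] by blast
  note [measurable] = bmeas_measurable[OF assms(2)] borel_measurable_integrable[OF assms(1)]
  show ?thesis
  proof (rule Bochner_Integration.integrable_bound)
    show "integrable M (\<lambda>x. C * norm (f x))" using assms(1) by simp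
    show "AE x in M. norm (f x * q x) \<le> norm (C * norm (f x))"
      using C by (intro AE_I2) (auto simp: abs_mult intro!: norm_mult_le_bound simp del: norm_mult)
  qed simp
qed

lemma bmeas_integrable: "q \<in> bmeas \<Longrightarrow> integrable M q"
  using integrable_mult_bmeas[of "\<lambda>_. 1" q] by simp

lemma norm_integral_mult_le:
  assumes f: "integrable M f" and q: "q \<in> borel_measurable M"
    and C: "\<And>x. x \<in> SU2 \<Longrightarrow> norm (q x) \<le> C"
  shows "norm (\<integral>x. f x * q x \<partial>M) \<le> C * L1norm M f"
proof -
  have "norm (\<integral>x. f x * q x \<partial>M) \<le> (\<integral>x. norm (f x * q x) \<partial>M)" by simp
  also have "\<dots> \<le> (\<integral>x. C * norm (f x) \<partial>M)"
  proof (rule integral_mono)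
    show "integrable M (\<lambda>x. norm (f x * q x))"
      by (intro integrable_norm integrable_mult_bmeas f bmeasI[OF q C])
  qed (use f C in \<open>auto intro!: norm_mult_le_bound simp del: norm_mult\<close>)
  finally show ?thesis by (simp add: L1norm_def)
qed

lemma integrable_pair_mult_bounded:
  assumes f: "integrable M f" and R [measurable]: "R \<in> borel_measurable (M \<Otimes>\<^sub>M M)"
    and C: "\<And>c y. c \<in> SU2 \<Longrightarrow> y \<in> SU2 \<Longrightarrow> norm (R (c, y)) \<le> C"
  shows "integrable (M \<Otimes>\<^sub>M M) (\<lambda>(c, y). (f y :: complex) * (R (c, y) :: complex))"
proof (rule Fubini_integrable)
  note [measurable] = borel_measurable_integrable[OF f]
  show "(\<lambda>(c, y). f y * R (c, y)) \<in> borel_measurable (M \<Otimes>\<^sub>M M)" by measurable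
  have bm: "(\<lambda>y. R (c, y)) \<in> bmeas" if "c \<in> SU2" for c
    using that by (intro bmeasI[of _ C]) (auto simp: C)
  then show "AE c in M. integrable M (\<lambda>y. case (c, y) of (c, y) \<Rightarrow> f y * R (c, y))"
    by (intro AE_I2) (simp add: integrable_mult_bmeas f)
  have "(\<integral>y. norm (f y * R (c, y)) \<partial>M) \<le> C * L1norm M f" if "c \<in> SU2" for c
    unfolding L1norm_def
    by (subst integral_mult_right_zero[symmetric], rule integral_mono)
       (use f C bm[OF that] that in \<open>auto intro!: norm_mult_le_bound integrable_norm integrable_mult_bmeas\<close>)
  then show "integrable M (\<lambda>c. \<integral>y. norm (case (c, y) of (c, y) \<Rightarrow> f y * R (c, y)) \<partial>M)"
    by (intro integrable_const_bound[where B = "C * L1norm M f"] AE_I2) auto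
qed

lemma integral_swap_bounded:
  assumes f: "integrable M f" and R [measurable]: "R \<in> borel_measurable (M \<Otimes>\<^sub>M M)"
    and C: "\<And>c y. c \<in> SU2 \<Longrightarrow> y \<in> SU2 \<Longrightarrow> norm (R (c, y)) \<le> C"
  shows "(\<integral>c. (\<integral>y. (f y :: complex) * (R (c, y) :: complex) \<partial>M) \<partial>M) = (\<integral>y. f y * (\<integral>c. R (c, y) \<partial>M) \<partial>M)"
  using Fubini_integral[OF integrable_pair_mult_bounded[OF assms]] by simp

lemma L1norm_left:
  assumes "g \<in> SU2" "integrable M f"
  shows "L1norm M (\<lambda>x. f (g ** x)) = L1norm M f"
  unfolding L1norm_def using assms by (subst integral_left[of g "\<lambda>x. norm (f x)"]) auto

lemma integrable_conv_kernel:
  fixes f g :: fn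
  assumes f: "integrable M f" and g: "integrable M g"
  shows "integrable (M \<Otimes>\<^sub>M M) (\<lambda>(y, x). f y * g (ctrans y ** x))"
proof (rule Fubini_integrable)
  note [measurable] = borel_measurable_integrable[OF f] borel_measurable_integrable[OF g]
  show "(\<lambda>(y, x). f y * g (ctrans y ** x)) \<in> borel_measurable (M \<Otimes>\<^sub>M M)" by measurable
  show "AE y in M. integrable M (\<lambda>x. case (y, x) of (y, x) \<Rightarrow> f y * g (ctrans y ** x))"
    by (intro AE_I2) (simp add: integrable_left g)
  have "(\<integral>x. norm (f y * g (ctrans y ** x)) \<partial>M) = norm (f y) * L1norm M g" if "y \<in> SU2" for y
    using L1norm_left[of "ctrans y" g] that g by (simp add: norm_mult L1norm_def)
  then have "integrable M (\<lambda>y. \<integral>x. norm (f y * g (ctrans y ** x)) \<partial>M) \<longleftrightarrow>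
      integrable M (\<lambda>y. norm (f y) * L1norm M g)"
    by (intro Bochner_Integration.integrable_cong) auto
  then show "integrable M (\<lambda>y. \<integral>x. norm (case (y, x) of (y, x) \<Rightarrow> f y * g (ctrans y ** x)) \<partial>M)"
    using f by simp
qed

lemma integrable_conv:
  assumes "integrable M f" "integrable M g"
  shows "integrable M (conv M f g)"
  using integrable_snd[OF integrable_conv_kernel[OF assms]] by (simp add: conv_def)

text \<open>Fubini, then the substitution of \<open>y ** x\<close> for \<open>x\<close> in the inner
  integral. This weak form of convolution removes the exceptional null sets; associativity,
  congruence and multiplicativity are all derived through it.\<close>

lemma conv_pairing:
  assumes f: "integrable M f" and g: "integrable M g" and q: "q \<in> bmeas"
  shows "(\<integral>x. conv M f g x * q x \<partial>M) = (\<integral>y. f y * (\<integral>x. g x * q (y ** x) \<partial>M) \<partial>M)"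
proof -
  note [measurable] = borel_measurable_integrable[OF f] borel_measurable_integrable[OF g]
    bmeas_measurable[OF q]
  obtain C where C: "\<And>x. x \<in> SU2 \<Longrightarrow> norm (q x) \<le> C" using bmeas_bound[OF q] by blast
  have "integrable (M \<Otimes>\<^sub>M M) (\<lambda>(y, x). f y * g (ctrans y ** x) * q x)"
  proof (rule Bochner_Integration.integrable_bound)
    show "integrable (M \<Otimes>\<^sub>M M) (\<lambda>z. C * norm (case z of (y, x) \<Rightarrow> f y * g (ctrans y ** x)))"
      using integrable_conv_kernel[OF f g] by simp
    show "AE z in M \<Otimes>\<^sub>M M. norm (case z of (y, x) \<Rightarrow> f y * g (ctrans y ** x) * q x)
        \<le> norm (C * norm (case z of (y, x) \<Rightarrow> f y * g (ctrans y ** x)))"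
      using C by (intro AE_I2)
        (auto simp: space_pair_measure abs_mult intro!: norm_mult_le_bound intro: order_trans[OF _ abs_ge_self])
  qed measurable
  then have "(\<integral>x. (\<integral>y. f y * g (ctrans y ** x) * q x \<partial>M) \<partial>M) = (\<integral>y. (\<integral>x. f y * g (ctrans y ** x) * q x \<partial>M) \<partial>M)"
    by (rule Fubini_integral)
  also have "\<dots> = (\<integral>y. f y * (\<integral>x. g (ctrans y ** x) * q x \<partial>M) \<partial>M)"
    by (simp add: mult.assoc)
  also have "\<dots> = (\<integral>y. f y * (\<integral>x. g x * q (y ** x) \<partial>M) \<partial>M)"
  proof (rule Bochner_Integration.integral_cong[OF refl])
    fix y assume "y \<in> space M"
    then have y: "y \<in> SU2" by simp
    have [measurable]: "(\<lambda>x. ctrans y ** x) \<in> measurable M M" using y by (simp add: measurable_left)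
    show "f y * (\<integral>x. g (ctrans y ** x) * q x \<partial>M) = f y * (\<integral>x. g x * q (y ** x) \<partial>M)"
      using integral_left[OF y, of "\<lambda>x. g (ctrans y ** x) * q x"] by (simp add: SU2_cancel y)
  qed
  finally show ?thesis by (simp add: conv_def)
qed

text \<open>Pairing \<open>f - g\<close> with its own conjugate phase gives the L1 norm of
  \<open>f - g\<close>.\<close>

lemma AE_eq_if_pairing_eq:
  assumes f: "integrable M f" and g: "integrable M g"
    and eq: "\<And>q. q \<in> bmeas \<Longrightarrow> (\<integral>x. f x * q x \<partial>M) = (\<integral>x. g x * q x \<partial>M)"
  shows "AE x in M. f x = g x"
proof -
  note [measurable] = borel_measurable_integrable[OF f] borel_measurable_integrable[OF g]
  define h q where "h x = f x - g x" and "q x = cnj (sgn (h x))" for x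
  have h: "integrable M h" using f g by (simp add: h_def [abs_def])
  note [measurable] = borel_measurable_integrable[OF h]
  have "q = (\<lambda>x. if h x = 0 then 0 else cnj (h x) / of_real (norm (h x)))"
    by (auto simp: q_def sgn_div_norm scaleR_conv_of_real divide_simps)
  moreover have "cnj \<in> borel_measurable borel"
    by (intro borel_measurable_continuous_onI continuous_intros)
  ultimately have "q \<in> borel_measurable M" by simp
  then have q: "q \<in> bmeas" by (rule bmeasI[of _ 1]) (simp add: q_def norm_sgn)
  have "h x * q x = of_real (norm (h x))" for x
    by (cases "h x = 0") (simp_all add: q_def sgn_div_norm scaleR_conv_of_real complex_norm_square[symmetric]
      power2_eq_square field_simps)
  then have "of_real (\<integral>x. norm (h x) \<partial>M) = (\<integral>x. h x * q x \<partial>M)" by simp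
  also have "\<dots> = (\<integral>x. f x * q x - g x * q x \<partial>M)" by (simp add: h_def left_diff_distrib)
  also have "\<dots> = 0" using eq[OF q] f g q by (simp add: integrable_mult_bmeas)
  finally have "(\<integral>x. norm (h x) \<partial>M) = 0" by simp
  then have "AE x in M. norm (h x) = 0"
    using h by (subst (asm) integral_nonneg_eq_0_iff_AE) auto
  then show ?thesis by (simp add: h_def)
qed

lemma L1norm_conv_le:
  assumes f: "integrable M f" and g: "integrable M g"
  shows "L1norm M (conv M f g) \<le> L1norm M f * L1norm M g"
proof -
  note [measurable] = borel_measurable_integrable[OF f] borel_measurable_integrable[OF g]
  define k where "k y x = norm (f y * g (ctrans y ** x))" for y x
  have k: "integrable (M \<Otimes>\<^sub>M M) (\<lambda>(y, x). k y x)"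
    using integrable_norm[OF integrable_conv_kernel[OF f g]] by (simp add: k_def split_def)
  have "L1norm M (conv M f g) \<le> (\<integral>x. (\<integral>y. k y x \<partial>M) \<partial>M)"
    unfolding L1norm_def
  proof (rule integral_mono)
    show "integrable M (\<lambda>x. norm (conv M f g x))" using integrable_conv[OF f g] by simp
    show "integrable M (\<lambda>x. \<integral>y. k y x \<partial>M)" using integrable_snd[OF k] by simp
    show "norm (conv M f g x) \<le> (\<integral>y. k y x \<partial>M)" for x by (simp add: conv_def k_def)
  qed
  also have "\<dots> = (\<integral>y. (\<integral>x. k y x \<partial>M) \<partial>M)" using k by (rule Fubini_integral)
  also have "\<dots> = (\<integral>y. norm (f y) * L1norm M g \<partial>M)"
    using L1norm_left[of "ctrans _" g] g
    by (intro Bochner_Integration.integral_cong) (simp_all add: k_def norm_mult L1norm_def)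
  finally show ?thesis by (simp add: L1norm_def)
qed

lemma bmeas_translated_pairing:
  assumes h: "integrable M h" and q: "q \<in> bmeas"
  shows "(\<lambda>w. \<integral>z. h z * q (w ** z) \<partial>M) \<in> bmeas"
proof -
  note [measurable] = borel_measurable_integrable[OF h] bmeas_measurable[OF q]
  obtain C where C: "\<And>x. x \<in> SU2 \<Longrightarrow> norm (q x) \<le> C" using bmeas_bound[OF q] by blast
  show ?thesis
  proof (rule bmeasI[of _ "C * L1norm M h"])
    show "(\<lambda>w. \<integral>z. h z * q (w ** z) \<partial>M) \<in> borel_measurable M" by measurable
    show "norm (\<integral>z. h z * q (w ** z) \<partial>M) \<le> C * L1norm M h" if "w \<in> SU2" for w
      using that h bmeas_left[OF q that] C by (intro norm_integral_mult_le) (auto simp: bmeas_measurable)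
  qed
qed

text \<open>Paired with a test function, both sides become the same triple integral of
  \<open>q\<close> over products, by associativity of the matrix product.\<close>

lemma conv_assoc_AE:
  assumes f: "integrable M f" and g: "integrable M g" and h: "integrable M h"
  shows "AE x in M. conv M (conv M f g) h x = conv M f (conv M g h) x"
proof (rule AE_eq_if_pairing_eq)
  fix q assume q: "q \<in> bmeas"
  note fg = integrable_conv[OF f g] and gh = integrable_conv[OF g h]
  have "(\<integral>x. conv M (conv M f g) h x * q x \<partial>M)
      = (\<integral>y. f y * (\<integral>x. g x * (\<integral>z. h z * q ((y ** x) ** z) \<partial>M) \<partial>M) \<partial>M)"
    unfolding conv_pairing[OF fg h q] conv_pairing[OF f g bmeas_translated_pairing[OF h q]] ..
  also have "\<dots> = (\<integral>y. f y * (\<integral>x. conv M g h x * q (y ** x) \<partial>M) \<partial>M)"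
    by (intro Bochner_Integration.integral_cong[OF refl])
       (simp add: conv_pairing[OF g h bmeas_left[OF q]] matrix_mul_assoc)
  also have "\<dots> = (\<integral>x. conv M f (conv M g h) x * q x \<partial>M)"
    unfolding conv_pairing[OF f gh q] ..
  finally show "(\<integral>x. conv M (conv M f g) h x * q x \<partial>M) = (\<integral>x. conv M f (conv M g h) x * q x \<partial>M)" .
qed (intro integrable_conv f g h)+

lemma integral_mult_cong_AE:
  assumes "integrable M f" "integrable M g" "AE x in M. f x = g x" "q \<in> borel_measurable M"
  shows "(\<integral>x. f x * q x \<partial>M) = (\<integral>x. g x * (q x :: complex) \<partial>M)"
  by (rule integral_cong_AE) (use assms in auto)

lemma conv_cong_AE:
  assumes f: "integrable M f" "integrable M f'" "AE x in M. f x = f' x"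
    and g: "integrable M g" "integrable M g'" "AE x in M. g x = g' x"
  shows "AE x in M. conv M f g x = conv M f' g' x"
proof (rule AE_eq_if_pairing_eq)
  fix q assume q: "q \<in> bmeas"
  have "(\<integral>x. conv M f g x * q x \<partial>M) = (\<integral>y. f y * (\<integral>x. g x * q (y ** x) \<partial>M) \<partial>M)"
    by (rule conv_pairing[OF f(1) g(1) q])
  also have "\<dots> = (\<integral>y. f' y * (\<integral>x. g x * q (y ** x) \<partial>M) \<partial>M)"
    using f by (intro integral_mult_cong_AE bmeas_measurable bmeas_translated_pairing g q)
  also have "\<dots> = (\<integral>y. f' y * (\<integral>x. g' x * q (y ** x) \<partial>M) \<partial>M)"
    using g bmeas_measurable[OF bmeas_left[OF q]]
    by (intro Bochner_Integration.integral_cong refl arg_cong[of _ _ "(*) _"] integral_mult_cong_AE) auto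
  also have "\<dots> = (\<integral>x. conv M f' g' x * q x \<partial>M)"
    by (rule conv_pairing[OF f(2) g(2) q, symmetric])
  finally show "(\<integral>x. conv M f g x * q x \<partial>M) = (\<integral>x. conv M f' g' x * q x \<partial>M)" .
qed (intro integrable_conv f g)+

lemma ZL1_integrable: "f \<in> ZL1 M \<Longrightarrow> integrable M f"
  by (simp add: ZL1_def)

lemma ZL1_commute: "f \<in> ZL1 M \<Longrightarrow> integrable M g \<Longrightarrow> AE x in M. conv M f g x = conv M g f x"
  by (simp add: ZL1_def)

text \<open>Forms in \<open>bilin1 M\<close> are controlled on the centre only, so the arguments
  \<open>conv M a (u i n)\<close> and \<open>conv M (v i n) a\<close> must be shown to lie
  there.\<close>

lemma ZL1_conv:
  assumes f: "f \<in> ZL1 M" and g: "g \<in> ZL1 M"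
  shows "conv M f g \<in> ZL1 M"
  unfolding ZL1_def
proof (intro CollectI conjI allI impI)
  show "integrable M (conv M f g)" by (intro integrable_conv ZL1_integrable f g)
  fix h :: fn assume h: "integrable M h"
  note i = ZL1_integrable[OF f] ZL1_integrable[OF g] h
  have "AE x in M. conv M (conv M f g) h x = conv M f (conv M g h) x"
    by (intro conv_assoc_AE i)
  moreover have "AE x in M. conv M f (conv M g h) x = conv M f (conv M h g) x"
    by (intro conv_cong_AE integrable_conv ZL1_commute g i) simp
  moreover have "AE x in M. conv M (conv M f h) g x = conv M f (conv M h g) x"
    by (intro conv_assoc_AE i)
  moreover have "AE x in M. conv M (conv M f h) g x = conv M (conv M h f) g x"
    by (intro conv_cong_AE integrable_conv ZL1_commute f i) simp
  moreover have "AE x in M. conv M (conv M h f) g x = conv M h (conv M f g) x"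
    by (intro conv_assoc_AE i)
  ultimately show "AE x in M. conv M (conv M f g) h x = conv M h (conv M f g) x"
    by eventually_elim simp
qed

text \<open>Substituting \<open>x ** y ** ctrans x\<close> for \<open>y\<close> leaves
  \<open>a\<close> unchanged and turns \<open>g (ctrans y ** x)\<close> into
  \<open>g (x ** ctrans y)\<close>; inversion and a left translation then give the other
  convolution. The substitutions need only measurability, so equality holds at every
  \<open>x\<close>.\<close>

lemma class_function_in_ZL1:
  assumes a: "a \<in> bmeas" and conj: "\<And>x y. x \<in> SU2 \<Longrightarrow> y \<in> SU2 \<Longrightarrow> a (x ** y) = a (y ** x)"
  shows "a \<in> ZL1 M"
  unfolding ZL1_def
proof (safe intro!: AE_I2 bmeas_integrable a)
  fix g :: fn and x assume g: "integrable M g" and "x \<in> space M"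
  then have x: "x \<in> SU2" by simp
  note [measurable] = borel_measurable_integrable[OF g] bmeas_measurable[OF a]
    measurable_left[OF x] measurable_right[OF x] measurable_left[OF SU2_ctrans[OF x]] measurable_right[OF SU2_ctrans[OF x]]
  have 1: "(\<lambda>y. a y * g (ctrans y ** x)) \<in> borel_measurable M" by measurable
  have "conv M a g x = (\<integral>y. a (x ** y) * g (ctrans (x ** y) ** x) \<partial>M)"
    unfolding conv_def by (rule integral_left[OF x 1, symmetric])
  also have "\<dots> = (\<integral>y. a (x ** (y ** ctrans x)) * g (ctrans (x ** (y ** ctrans x)) ** x) \<partial>M)"
    by (rule integral_right[OF SU2_ctrans[OF x], symmetric]) measurable
  also have "\<dots> = (\<integral>y. g (x ** ctrans y) * a y \<partial>M)"
    using conj[OF x, of "_ ** ctrans x"] x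
    by (intro Bochner_Integration.integral_cong)
       (auto simp: ctrans_mult SU2_cancel simp flip: matrix_mul_assoc simp: SU2_ctrans_mult)
  also have "\<dots> = (\<integral>y. g (x ** y) * a (ctrans (x ** y) ** x) \<partial>M)"
    using x by (subst integral_ctrans[symmetric])
       (auto intro!: Bochner_Integration.integral_cong simp: ctrans_mult SU2_cancel simp flip: matrix_mul_assoc simp: SU2_ctrans_mult)
  also have "\<dots> = conv M g a x"
    unfolding conv_def by (rule integral_left[OF x, where f = "\<lambda>y. g y * a (ctrans y ** x)"]) measurable
  finally show "conv M a g x = conv M g a x" .
qed

text \<open>Commuting \<open>f\<close> with the translate of \<open>g\<close> by \<open>c\<close> shows that the pairing does not change when
  \<open>y\<close> is conjugated by \<open>c\<close>; averaging over \<open>c\<close> then brings in the functional equation of \<open>p\<close>.\<close>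

lemma spherical_multiplicative:
  assumes f: "f \<in> ZL1 M" and g: "integrable M g" and p: "p \<in> bmeas"
    and spherical: "\<And>x y. x \<in> SU2 \<Longrightarrow> y \<in> SU2 \<Longrightarrow> (\<integral>c. p (c ** y ** ctrans c ** x) \<partial>M) = p y * p x"
  shows "(\<integral>x. conv M f g x * p x \<partial>M) = (\<integral>x. f x * p x \<partial>M) * (\<integral>x. g x * p x \<partial>M)"
proof -
  note fi = ZL1_integrable[OF f]
  note [measurable] = borel_measurable_integrable[OF g] borel_measurable_integrable[OF fi] bmeas_measurable[OF p]
  obtain C where C: "\<And>x. x \<in> SU2 \<Longrightarrow> norm (p x) \<le> C" using bmeas_bound[OF p] by blast
  define I where "I = (\<integral>x. conv M f g x * p x \<partial>M)"
  define Q where "Q = (\<lambda>(c, y). \<integral>x. g x * p (c ** y ** ctrans c ** x) \<partial>M)"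
  have conj: "I = (\<integral>y. f y * Q (c, y) \<partial>M)" if c: "c \<in> SU2" for c
  proof -
    define gc where "gc x = g (c ** x)" for x
    have gc: "integrable M gc" unfolding gc_def [abs_def] using integrable_left[OF c g] .
    note pc = bmeas_left[OF p c]
    have "I = (\<integral>x. conv M g f x * p x \<partial>M)"
      unfolding I_def by (intro integral_mult_cong_AE integrable_conv ZL1_commute f fi g) measurable
    also have "\<dots> = (\<integral>y. g y * (\<integral>x. f x * p (y ** x) \<partial>M) \<partial>M)"
      by (rule conv_pairing[OF g fi p])
    also have "\<dots> = (\<integral>y. g (c ** y) * (\<integral>x. f x * p ((c ** y) ** x) \<partial>M) \<partial>M)"
      by (rule integral_left[OF c, symmetric]) measurable
    also have "\<dots> = (\<integral>x. conv M gc f x * p (c ** x) \<partial>M)"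
      by (subst conv_pairing[OF gc fi pc]) (simp add: gc_def matrix_mul_assoc)
    also have "\<dots> = (\<integral>x. conv M f gc x * p (c ** x) \<partial>M)"
      using ZL1_commute[OF f gc] bmeas_measurable[OF pc]
      by (intro integral_mult_cong_AE integrable_conv fi gc) auto
    also have "\<dots> = (\<integral>y. f y * (\<integral>x. g (c ** x) * p (c ** (y ** x)) \<partial>M) \<partial>M)"
      by (subst conv_pairing[OF fi gc pc]) (simp add: gc_def)
    also have "\<dots> = (\<integral>y. f y * Q (c, y) \<partial>M)"
    proof (rule Bochner_Integration.integral_cong[OF refl])
      fix y assume "y \<in> space M"
      then have y: "y \<in> SU2" by simp
      then have [measurable]: "(\<lambda>x. c ** y ** ctrans c ** x) \<in> measurable M M"
        using c by (intro measurable_left) simp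
      have "Q (c, y) = (\<integral>x. g (c ** x) * p (c ** y ** ctrans c ** (c ** x)) \<partial>M)"
        unfolding Q_def split by (rule integral_left[OF c, symmetric]) measurable
      also have "\<dots> = (\<integral>x. g (c ** x) * p (c ** (y ** x)) \<partial>M)"
        using c by (simp add: SU2_cancel flip: matrix_mul_assoc)
      finally show "f y * (\<integral>x. g (c ** x) * p (c ** (y ** x)) \<partial>M) = f y * Q (c, y)" by simp
    qed
    finally show ?thesis .
  qed
  have Qm: "Q \<in> borel_measurable (M \<Otimes>\<^sub>M M)" unfolding Q_def by measurable
  have Qb: "norm (Q (c, y)) \<le> C * L1norm M g" if "c \<in> SU2" "y \<in> SU2" for c y
  proof -
    have "c ** y ** ctrans c \<in> SU2" using that by simp
    then show ?thesis unfolding Q_def split using C bmeas_measurable[OF bmeas_left[OF p]]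
      by (intro norm_integral_mult_le g) auto
  qed
  have Q: "(\<integral>c. Q (c, y) \<partial>M) = p y * (\<integral>x. g x * p x \<partial>M)" if y: "y \<in> SU2" for y
  proof -
    have [measurable]: "(\<lambda>c. y) \<in> measurable (M \<Otimes>\<^sub>M M) M" using y by simp
    have "(\<integral>c. Q (c, y) \<partial>M) = (\<integral>x. g x * (\<integral>c. p (c ** y ** ctrans c ** x) \<partial>M) \<partial>M)"
      using integral_swap_bounded[OF g, of "\<lambda>(c, x). p (c ** y ** ctrans c ** x)" C] C y
      by (simp add: Q_def)
    also have "\<dots> = (\<integral>x. p y * (g x * p x) \<partial>M)"
      using spherical[OF _ y] by (intro Bochner_Integration.integral_cong) auto
    finally show ?thesis by simp
  qed
  have "I = (\<integral>c. I \<partial>M)" by simp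
  also have "\<dots> = (\<integral>c. (\<integral>y. f y * Q (c, y) \<partial>M) \<partial>M)"
    using conj by (intro Bochner_Integration.integral_cong) auto
  also have "\<dots> = (\<integral>y. f y * (\<integral>c. Q (c, y) \<partial>M) \<partial>M)"
    by (rule integral_swap_bounded[OF fi Qm Qb])
  also have "\<dots> = (\<integral>y. f y * p y * (\<integral>x. g x * p x \<partial>M) \<partial>M)"
    using Q by (intro Bochner_Integration.integral_cong) auto
  finally show ?thesis by (simp add: I_def)
qed

end

subsection \<open>The functional equation of the characters\<close>

text \<open>Quaternions as matrices: the pattern that \<open>SU2_entries\<close> forces on the
  members of \<open>SU2\<close>.\<close>

definition quat :: "complex \<Rightarrow> complex \<Rightarrow> mat2" where
  "quat a b = (\<chi> i j. if i = 1 then (if j = 1 then a else b) else (if j = 1 then - cnj b else cnj a))"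

lemma quat_entries [simp]:
  "quat a b $ 1 $ 1 = a" "quat a b $ 1 $ 2 = b" "quat a b $ 2 $ 1 = - cnj b" "quat a b $ 2 $ 2 = cnj a"
  by (simp_all add: quat_def)

lemma quat_in_SU2:
  assumes "a * cnj a + b * cnj b = 1"
  shows "quat a b \<in> SU2"
  using assms unfolding SU2_def
  by (simp add: vec_eq_iff matrix_matrix_mult_def ctrans_def mat_def sum_2 forall_2 det_2 mult.commute add.commute)

lemma SU2_coords_sq_sum:
  assumes "U \<in> SU2"
  shows "(Re (U$1$1))\<^sup>2 + (Im (U$1$1))\<^sup>2 + (Re (U$1$2))\<^sup>2 + (Im (U$1$2))\<^sup>2 = 1"
  using arg_cong[OF SU2_entries(3)[OF assms], of Re] by (simp add: power2_eq_square)

lemma SU2_coords_le_1: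
  assumes "U \<in> SU2"
  shows "\<bar>Re (U$1$1)\<bar> \<le> 1" "\<bar>Im (U$1$1)\<bar> \<le> 1" "\<bar>Re (U$1$2)\<bar> \<le> 1" "\<bar>Im (U$1$2)\<bar> \<le> 1"
  unfolding abs_square_le_1[symmetric]
  using SU2_coords_sq_sum[OF assms] zero_le_power2[of "Re (U$1$1)"] zero_le_power2[of "Im (U$1$1)"]
    zero_le_power2[of "Re (U$1$2)"] zero_le_power2[of "Im (U$1$2)"] by linarith+

lemma matrix2_mult_entries:
  fixes U V :: mat2
  shows "(U ** V) $ i $ j = U$i$1 * V$1$j + U$i$2 * V$2$j"
  by (simp add: matrix_matrix_mult_def sum_2)

text \<open>The scalar part of a quaternion product: product of the scalar parts minus the inner
  product of the imaginary parts. It equals half the trace, the only quantity on which the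
  characters depend.\<close>

lemma SU2_Re_mult:
  assumes "U \<in> SU2" "V \<in> SU2"
  shows "Re ((U ** V)$1$1) = Re (U$1$1) * Re (V$1$1)
    - (Im (V$1$1) * Im (U$1$1) + Re (V$1$2) * Re (U$1$2) + Im (V$1$2) * Im (U$1$2))"
  by (simp add: matrix2_mult_entries SU2_entries[OF assms(2)] algebra_simps)

lemma SU2_Re_mult_commute:
  assumes "U \<in> SU2" "V \<in> SU2"
  shows "Re ((U ** V)$1$1) = Re ((V ** U)$1$1)"
  by (simp add: SU2_Re_mult assms algebra_simps)

lemma SU2_Re_conj:
  assumes "c \<in> SU2" "U \<in> SU2"
  shows "Re ((c ** U ** ctrans c)$1$1) = Re (U$1$1)"
  using SU2_Re_mult_commute[of "c ** U" "ctrans c"] assms by (simp add: SU2_cancel)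

text \<open>Conjugation rotates the imaginary quaternions: \<open>\<alpha>\<close> is the coordinate
  along an axis, and every rotation about that axis occurs. The coordinates are parameters, so that
  one argument about rotations serves all three axes by cyclic permutation.\<close>

definition rotates :: "(mat2 \<Rightarrow> real) \<Rightarrow> (mat2 \<Rightarrow> real) \<Rightarrow> (mat2 \<Rightarrow> real) \<Rightarrow> bool" where
  "rotates \<alpha> \<beta> \<gamma> \<longleftrightarrow> (\<forall>s. \<exists>g\<in>SU2. \<forall>Z\<in>SU2.
     \<alpha> (g ** Z ** ctrans g) = \<alpha> Z \<and>
     \<beta> (g ** Z ** ctrans g) = \<beta> Z * cos s - \<gamma> Z * sin s \<and>
     \<gamma> (g ** Z ** ctrans g) = \<beta> Z * sin s + \<gamma> Z * cos s)"

text \<open>The rotation by \<open>s\<close> about a coordinate axis is conjugation by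
  \<open>cos (s/2) + sin (s/2) * e\<close>, with \<open>e\<close> the imaginary unit of that axis;
  the half angle reflects the double cover of SO(3) by SU(2).\<close>

lemma rotates_coords:
  defines "z1 \<equiv> \<lambda>Z::mat2. Im (Z$1$1)" and "z2 \<equiv> \<lambda>Z::mat2. Re (Z$1$2)" and "z3 \<equiv> \<lambda>Z::mat2. Im (Z$1$2)"
  shows "rotates z1 z2 z3" "rotates z2 z3 z1" "rotates z3 z1 z2"
proof -
  have conj: "(g ** Z ** ctrans g)$1$j =
      (g$1$1 * Z$1$1 - g$1$2 * cnj (Z$1$2)) * cnj (g$j$1) + (g$1$1 * Z$1$2 + g$1$2 * cnj (Z$1$1)) * cnj (g$j$2)"
    if "Z \<in> SU2" for g Z :: mat2 and j
    by (simp add: matrix2_mult_entries SU2_entries[OF that] ctrans_def)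
  have cs: "cos s = (cos (s/2))\<^sup>2 - (sin (s/2))\<^sup>2" "sin s = 2 * sin (s/2) * cos (s/2)"
    "(sin (s/2))\<^sup>2 + (cos (s/2))\<^sup>2 = 1" for s :: real
    using cos_double[of "s/2"] sin_double[of "s/2"] by simp_all
  show "rotates z1 z2 z3"
    unfolding rotates_def
  proof
    fix s :: real
    define a b where "a = cos (s/2)" and "b = sin (s/2)"
    note e = cs[of s, folded a_def b_def]
    define g where "g = quat (Complex a b) (0)"
    have g: "g \<in> SU2"
      unfolding g_def using e(3) by (intro quat_in_SU2) (simp add: complex_eq_iff power2_eq_square)
    have "z1 (g ** Z ** ctrans g) = z1 Z"
      "z2 (g ** Z ** ctrans g) = z2 Z * cos s - z3 Z * sin s"
      "z3 (g ** Z ** ctrans g) = z2 Z * sin s + z3 Z * cos s" if Z: "Z \<in> SU2" for Z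
    proof -
      define p q r t where "p = Re (Z$1$1)" and "q = Im (Z$1$1)" and "r = Re (Z$1$2)" and "t = Im (Z$1$2)"
      note defs = z1_def z2_def z3_def p_def[symmetric] q_def[symmetric] r_def[symmetric] t_def[symmetric]
      show "z1 (g ** Z ** ctrans g) = z1 Z"
        unfolding defs conj[OF Z] g_def using e(3) by (simp add: defs) algebra?
      show "z2 (g ** Z ** ctrans g) = z2 Z * cos s - z3 Z * sin s"
        unfolding defs conj[OF Z] g_def e(1,2) by (simp add: defs) algebra
      show "z3 (g ** Z ** ctrans g) = z2 Z * sin s + z3 Z * cos s"
        unfolding defs conj[OF Z] g_def e(1,2) by (simp add: defs) algebra
    qed
    then show "\<exists>g\<in>SU2. \<forall>Z\<in>SU2. z1 (g ** Z ** ctrans g) = z1 Z \<and>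
       z2 (g ** Z ** ctrans g) = z2 Z * cos s - z3 Z * sin s \<and>
       z3 (g ** Z ** ctrans g) = z2 Z * sin s + z3 Z * cos s"
      using g by blast
  qed
  show "rotates z2 z3 z1"
    unfolding rotates_def
  proof
    fix s :: real
    define a b where "a = cos (s/2)" and "b = sin (s/2)"
    note e = cs[of s, folded a_def b_def]
    define g where "g = quat (of_real a) (of_real b)"
    have g: "g \<in> SU2"
      unfolding g_def using e(3) by (intro quat_in_SU2) (simp add: complex_eq_iff power2_eq_square)
    have "z2 (g ** Z ** ctrans g) = z2 Z"
      "z3 (g ** Z ** ctrans g) = z3 Z * cos s - z1 Z * sin s"
      "z1 (g ** Z ** ctrans g) = z3 Z * sin s + z1 Z * cos s" if Z: "Z \<in> SU2" for Z
    proof -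
      define p q r t where "p = Re (Z$1$1)" and "q = Im (Z$1$1)" and "r = Re (Z$1$2)" and "t = Im (Z$1$2)"
      note defs = z1_def z2_def z3_def p_def[symmetric] q_def[symmetric] r_def[symmetric] t_def[symmetric]
      show "z2 (g ** Z ** ctrans g) = z2 Z"
        unfolding defs conj[OF Z] g_def using e(3) by (simp add: defs) algebra?
      show "z3 (g ** Z ** ctrans g) = z3 Z * cos s - z1 Z * sin s"
        unfolding defs conj[OF Z] g_def e(1,2) by (simp add: defs) algebra
      show "z1 (g ** Z ** ctrans g) = z3 Z * sin s + z1 Z * cos s"
        unfolding defs conj[OF Z] g_def e(1,2) by (simp add: defs) algebra
    qed
    then show "\<exists>g\<in>SU2. \<forall>Z\<in>SU2. z2 (g ** Z ** ctrans g) = z2 Z \<and>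
       z3 (g ** Z ** ctrans g) = z3 Z * cos s - z1 Z * sin s \<and>
       z1 (g ** Z ** ctrans g) = z3 Z * sin s + z1 Z * cos s"
      using g by blast
  qed
  show "rotates z3 z1 z2"
    unfolding rotates_def
  proof
    fix s :: real
    define a b where "a = cos (s/2)" and "b = sin (s/2)"
    note e = cs[of s, folded a_def b_def]
    define g where "g = quat (of_real a) (Complex 0 b)"
    have g: "g \<in> SU2"
      unfolding g_def using e(3) by (intro quat_in_SU2) (simp add: complex_eq_iff power2_eq_square)
    have "z3 (g ** Z ** ctrans g) = z3 Z"
      "z1 (g ** Z ** ctrans g) = z1 Z * cos s - z2 Z * sin s"
      "z2 (g ** Z ** ctrans g) = z1 Z * sin s + z2 Z * cos s" if Z: "Z \<in> SU2" for Z
    proof -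
      define p q r t where "p = Re (Z$1$1)" and "q = Im (Z$1$1)" and "r = Re (Z$1$2)" and "t = Im (Z$1$2)"
      note defs = z1_def z2_def z3_def p_def[symmetric] q_def[symmetric] r_def[symmetric] t_def[symmetric]
      show "z3 (g ** Z ** ctrans g) = z3 Z"
        unfolding defs conj[OF Z] g_def using e(3) by (simp add: defs) algebra?
      show "z1 (g ** Z ** ctrans g) = z1 Z * cos s - z2 Z * sin s"
        unfolding defs conj[OF Z] g_def e(1,2) by (simp add: defs) algebra
      show "z2 (g ** Z ** ctrans g) = z1 Z * sin s + z2 Z * cos s"
        unfolding defs conj[OF Z] g_def e(1,2) by (simp add: defs) algebra
    qed
    then show "\<exists>g\<in>SU2. \<forall>Z\<in>SU2. z3 (g ** Z ** ctrans g) = z3 Z \<and>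
       z1 (g ** Z ** ctrans g) = z1 Z * cos s - z2 Z * sin s \<and>
       z2 (g ** Z ** ctrans g) = z1 Z * sin s + z2 Z * cos s"
      using g by blast
  qed
qed

section \<open>Chebyshev polynomials of degree \<open>3 ^ k\<close> and the characters as
  polynomials\<close>

fun cheb :: "nat \<Rightarrow> real poly" where
  "cheb 0 = [:0, 1:]"
| "cheb (Suc k) = smult 4 (cheb k ^ 3) - smult 3 (cheb k)"

text \<open>The normalised character of the irreducible representation of dimension \<open>n = 3 ^ k\<close>,
  \<open>sin (n * \<theta>) / (n * sin \<theta>)\<close>, as a polynomial in \<open>cos \<theta>\<close>.\<close>

fun sph_poly :: "nat \<Rightarrow> real poly" where
  "sph_poly 0 = 1"
| "sph_poly (Suc k) = smult (1/3) (sph_poly k * (smult 4 (cheb k ^ 2) - 1))"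

lemma cheb_cos: "poly (cheb k) (cos \<theta>) = cos (3 ^ k * \<theta>)"
proof (induction k)
  case (Suc k)
  then show ?case using cos_treble_cos[of "3 ^ k * \<theta>"] by (simp add: mult.assoc)
qed simp

text \<open>Multiplied out, so that it remains valid where \<open>sin \<theta> = 0\<close>.\<close>

lemma sph_poly_cos: "3 ^ k * poly (sph_poly k) (cos \<theta>) * sin \<theta> = sin (3 ^ k * \<theta>)"
proof (induction k)
  case (Suc k)
  have "sin (3 * x) = sin x * (4 * (cos x)\<^sup>2 - 1)" for x :: real
  proof -
    have "sin (3 * x) = sin (2 * x + x)" by simp
    also have "\<dots> = 2 * sin x * cos x * cos x + (2 * (cos x)\<^sup>2 - 1) * sin x"
      by (simp only: sin_add sin_double cos_double_cos)
    finally show ?thesis by (simp add: algebra_simps power2_eq_square)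
  qed
  from this[of "3 ^ k * \<theta>"] show ?case
    by (simp add: cheb_cos mult.assoc flip: Suc.IH)
qed simp

text \<open>With \<open>n = 3 ^ k\<close>, the derivative of \<open>cos (n * \<theta>)\<close> with
  respect to \<open>cos \<theta>\<close> is \<open>n * sin (n * \<theta>) / sin \<theta>\<close>,
  that is \<open>n^2\<close> times the normalised character. Thus averages of the character over an
  interval can be evaluated at its end points.\<close>

lemma pderiv_cheb: "pderiv (cheb k) = smult (9 ^ k) (sph_poly k)"
proof (induction k)
  case (Suc k)
  have "poly (pderiv (cheb (Suc k))) x = poly (smult (9 ^ Suc k) (sph_poly (Suc k))) x" for x
    by (simp add: pderiv_diff pderiv_smult pderiv_power Suc.IH algebra_simps power2_eq_square)
  then show ?case by (simp only: poly_eq_poly_eq_iff[symmetric] fun_eq_iff) blast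
qed (simp add: pderiv_pCons)

lemma poly_cheb_minus: "poly (cheb k) (- x) = - poly (cheb k) x"
  by (induction k) (simp_all add: power3_eq_cube)

lemma poly_sph_poly_minus: "poly (sph_poly k) (- x) = poly (sph_poly k) x"
  by (induction k) (simp_all add: poly_cheb_minus)

lemma poly_cheb_1: "poly (cheb k) 1 = 1"
  by (induction k) simp_all

lemma poly_sph_poly_1: "poly (sph_poly k) 1 = 1"
  by (induction k) (simp_all add: poly_cheb_1)

lemma abs_cheb_le_1: "\<bar>x\<bar> \<le> 1 \<Longrightarrow> \<bar>poly (cheb k) x\<bar> \<le> 1"
  using cheb_cos[of k "arccos x"] by (simp add: abs_le_iff)

text \<open>The factor is \<open>(4 * t^2 - 1) / 3\<close> with \<open>t = poly (cheb k) x\<close>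
  in [-1, 1]. A factor, unlike a quotient, makes sense at the zeros of \<open>sph_poly k\<close>
  too.\<close>

lemma sph_poly_factor:
  assumes "\<bar>x\<bar> \<le> 1"
  obtains r where "-1/3 \<le> r" "r \<le> 1" "poly (sph_poly (Suc k)) x = r * poly (sph_poly k) x"
proof
  have "(poly (cheb k) x)\<^sup>2 \<le> 1"
    using abs_cheb_le_1[OF assms, of k] by (simp add: abs_square_le_1)
  then show "-1/3 \<le> (4 * (poly (cheb k) x)\<^sup>2 - 1) / 3" "(4 * (poly (cheb k) x)\<^sup>2 - 1) / 3 \<le> 1"
    by simp_all
qed (simp add: field_simps)

lemma abs_sph_poly_le_1:
  assumes "\<bar>x\<bar> \<le> 1"
  shows "\<bar>poly (sph_poly k) x\<bar> \<le> 1"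
proof (induction k)
  case (Suc k)
  obtain r where r: "-1/3 \<le> r" "r \<le> 1" "poly (sph_poly (Suc k)) x = r * poly (sph_poly k) x"
    using sph_poly_factor[OF assms] .
  have "\<bar>r\<bar> * \<bar>poly (sph_poly k) x\<bar> \<le> 1 * 1"
    using r Suc by (intro mult_mono) auto
  then show ?case by (simp only: r(3) abs_mult mult_1)
qed simp

text \<open>The factor \<open>r \<ge> -1/3\<close> relating consecutive terms satisfies \<open>(1 - r)\<^sup>2 \<le> 2 * (1 - r\<^sup>2)\<close>,
  which makes the sum telescope.\<close>

lemma sum_sph_poly_diff_sq_le:
  assumes "\<bar>x\<bar> \<le> 1"
  shows "(\<Sum>k<K. (poly (sph_poly k) x - poly (sph_poly (Suc k)) x)\<^sup>2) \<le> 2"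
proof -
  have "(poly (sph_poly k) x - poly (sph_poly (Suc k)) x)\<^sup>2
      \<le> 2 * ((poly (sph_poly k) x)\<^sup>2 - (poly (sph_poly (Suc k)) x)\<^sup>2)" for k
  proof -
    define p where "p = poly (sph_poly k) x"
    obtain r where r: "-1/3 \<le> r" "r \<le> 1" "poly (sph_poly (Suc k)) x = r * p"
      using sph_poly_factor[OF assms, of k] unfolding p_def .
    \<comment> \<open>\<open>(1 - r) * (3 * r + 1)\<close> is
      \<open>2 * (1 - r^2) - (1 - r)^2\<close>; its sign is what requires
      \<open>r >= -1/3\<close>.\<close>
    have "0 \<le> (1 - r) * (3 * r + 1) * p\<^sup>2" using r by (intro mult_nonneg_nonneg) auto
    then show ?thesis unfolding r(3) p_def[symmetric]
      by (simp add: algebra_simps power2_eq_square)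
  qed
  then have "(\<Sum>k<K. (poly (sph_poly k) x - poly (sph_poly (Suc k)) x)\<^sup>2)
      \<le> (\<Sum>k<K. 2 * ((poly (sph_poly k) x)\<^sup>2 - (poly (sph_poly (Suc k)) x)\<^sup>2))"
    by (intro sum_mono)
  also have "\<dots> = 2 * (1 - (poly (sph_poly K) x)\<^sup>2)"
    using sum_lessThan_telescope'[of "\<lambda>k. (poly (sph_poly k) x)\<^sup>2" K]
    by (simp only: sum_distrib_left[symmetric]) simp
  also have "\<dots> \<le> 2" by simp
  finally show ?thesis .
qed

section \<open>Averages over a conjugacy class\<close>

context haar
begin

text \<open>Infinitesimal form of invariance. The difference quotients at \<open>1 / (n + 1)\<close>
  have integral 0 and, by the mean value theorem, are dominated by \<open>C\<close>.\<close>

lemma integral_derivative_eq_0: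
  fixes K K' :: "real \<Rightarrow> mat2 \<Rightarrow> real"
  assumes deriv: "\<And>s c. c \<in> SU2 \<Longrightarrow> ((\<lambda>s. K s c) has_real_derivative K' s c) (at s)"
    and bound: "\<And>s c. c \<in> SU2 \<Longrightarrow> \<bar>K' s c\<bar> \<le> C"
    and int: "\<And>s. integrable M (K s)" and meas: "K' 0 \<in> borel_measurable M"
    and const: "\<And>s. (\<integral>c. K s c \<partial>M) = (\<integral>c. K 0 c \<partial>M)"
  shows "(\<integral>c. K' 0 c \<partial>M) = 0"
proof -
  define D where "D n c = (K (inverse (real (Suc n))) c - K 0 c) / inverse (real (Suc n))" for n c
  have D0: "(\<integral>c. D n c \<partial>M) = 0" for n
    using int const[of "inverse (real (Suc n))"] by (simp add: D_def)
  have "(\<lambda>n. \<integral>c. D n c \<partial>M) \<longlonglongrightarrow> (\<integral>c. K' 0 c \<partial>M)"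
  proof (rule integral_dominated_convergence[where w = "\<lambda>_. C"])
    show "D n \<in> borel_measurable M" for n
      using int unfolding D_def[abs_def] by (intro borel_measurable_divide borel_measurable_diff) auto
    show "AE c in M. (\<lambda>n. D n c) \<longlonglongrightarrow> K' 0 c"
    proof (rule AE_I2)
      fix c assume "c \<in> space M"
      then have "((\<lambda>h. (K (0 + h) c - K 0 c) / h) \<longlongrightarrow> K' 0 c) (at 0)"
        using deriv[of c 0] by (simp add: DERIV_def)
      moreover have "filterlim (\<lambda>n. inverse (real (Suc n))) (at 0) sequentially"
        using LIMSEQ_inverse_real_of_nat by (auto simp: filterlim_at)
      ultimately show "(\<lambda>n. D n c) \<longlonglongrightarrow> K' 0 c"
        using filterlim_compose by (fastforce simp: D_def)
    qed
    show "AE c in M. norm (D n c) \<le> C" for n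
    proof (rule AE_I2)
      fix c assume "c \<in> space M"
      then have c: "c \<in> SU2" by simp
      obtain z where "K (inverse (real (Suc n))) c - K 0 c = inverse (real (Suc n)) * K' z c"
        using MVT2[of 0 "inverse (real (Suc n))" "\<lambda>s. K s c" "\<lambda>s. K' s c"] deriv[OF c] by auto
      then show "norm (D n c) \<le> C" using bound[OF c] by (simp add: D_def)
    qed
  qed (use meas in auto)
  then show ?thesis by (simp add: D0 LIMSEQ_const_iff)
qed

text \<open>The integrand is the second derivative at 0 of \<open>T ^ (m + 1) / (m + 1)\<close>
  along the rotations about the axis of \<open>\<alpha>\<close>. The integral of the first
  derivative does not depend on the angle, by left invariance, so the second derivative integrates
  to 0. For \<open>m = 0\<close> the truncated exponent is harmless, its term having the factor
  0.\<close>

lemma rotation_moment: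
  assumes rot: "rotates \<alpha> \<beta> \<gamma>" and y: "y \<in> SU2"
    and cont: "continuous_on UNIV \<alpha>" "continuous_on UNIV \<beta>" "continuous_on UNIV \<gamma>"
    and bd: "\<And>Z. Z \<in> SU2 \<Longrightarrow> \<bar>\<alpha> Z\<bar> \<le> 1" "\<And>Z. Z \<in> SU2 \<Longrightarrow> \<bar>\<beta> Z\<bar> \<le> 1" "\<And>Z. Z \<in> SU2 \<Longrightarrow> \<bar>\<gamma> Z\<bar> \<le> 1"
    and x: "\<bar>x1\<bar> \<le> 1" "\<bar>x2\<bar> \<le> 1" "\<bar>x3\<bar> \<le> 1"
    and T: "\<And>Z. T Z = x1 * \<alpha> Z + x2 * \<beta> Z + x3 * \<gamma> Z"
  shows "(\<integral>c. real m * (x3 * \<beta> (c ** y ** ctrans c) - x2 * \<gamma> (c ** y ** ctrans c))\<^sup>2 * T (c ** y ** ctrans c) ^ (m - 1)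
      - (x2 * \<beta> (c ** y ** ctrans c) + x3 * \<gamma> (c ** y ** ctrans c)) * T (c ** y ** ctrans c) ^ m \<partial>M) = 0"
proof -
  define W where "W c = c ** y ** ctrans c" for c :: mat2
  have W: "W c \<in> SU2" if "c \<in> SU2" for c using that y by (simp add: W_def)
  have contW: "continuous_on UNIV W" unfolding W_def[abs_def] by (intro continuous_intros)
  define a b where "a Z = x2 * \<beta> Z + x3 * \<gamma> Z" and "b Z = x3 * \<beta> Z - x2 * \<gamma> Z" for Z
  \<comment> \<open>\<open>S s Z\<close> is \<open>T\<close> evaluated at \<open>Z\<close> rotated
    by \<open>s\<close>, \<open>S'\<close> is its derivative in \<open>s\<close>, and
    \<open>K\<close> is the derivative of \<open>S ^ (m + 1) / (m + 1)\<close>.\<close>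
  define S where "S s Z = x1 * \<alpha> Z + a Z * cos s + b Z * sin s" for s Z
  define S' where "S' s Z = b Z * cos s - a Z * sin s" for s Z
  define K where "K s c = S' s (W c) * S s (W c) ^ m" for s c
  define K' where "K' s c = real m * (S' s (W c))\<^sup>2 * S s (W c) ^ (m - 1)
     - (a (W c) * cos s + b (W c) * sin s) * S s (W c) ^ m" for s c
  have prod1: "\<bar>u * v\<bar> \<le> 1" if "\<bar>u\<bar> \<le> 1" "\<bar>v\<bar> \<le> 1" for u v :: real
    using mult_mono[of "\<bar>u\<bar>" 1 "\<bar>v\<bar>" 1] that by (simp add: abs_mult)
  have prodC: "\<bar>u * v\<bar> \<le> C" if "\<bar>u\<bar> \<le> C" "\<bar>v\<bar> \<le> 1" for u v C :: real
    using mult_mono[of "\<bar>u\<bar>" C "\<bar>v\<bar>" 1] that by (simp add: abs_mult)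
  have ab: "\<bar>a Z\<bar> \<le> 2" "\<bar>b Z\<bar> \<le> 2" if "Z \<in> SU2" for Z
    unfolding a_def b_def
    using prod1[OF x(2) bd(2)[OF that]] prod1[OF x(3) bd(3)[OF that]]
      prod1[OF x(3) bd(2)[OF that]] prod1[OF x(2) bd(3)[OF that]] by linarith+
  have trig: "\<bar>a Z * cos s\<bar> \<le> 2" "\<bar>b Z * sin s\<bar> \<le> 2" "\<bar>b Z * cos s\<bar> \<le> 2" "\<bar>a Z * sin s\<bar> \<le> 2" if "Z \<in> SU2" for s Z
    using ab[OF that] by (auto intro!: prodC)
  have Sb: "\<bar>S s Z\<bar> \<le> 5" if "Z \<in> SU2" for s Z
    unfolding S_def using prod1[OF x(1) bd(1)[OF that]] trig[OF that, of s] by linarith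
  have S'b: "\<bar>S' s Z\<bar> \<le> 4" if "Z \<in> SU2" for s Z
    unfolding S'_def using trig[OF that, of s] by linarith
  have S''b: "\<bar>a Z * cos s + b Z * sin s\<bar> \<le> 4" if "Z \<in> SU2" for s Z
    using trig[OF that, of s] by linarith
  have Spow: "\<bar>S s Z\<bar> ^ n \<le> 5 ^ n" if "Z \<in> SU2" for s Z n
    using Sb[OF that] by (intro power_mono) auto
  have contK: "continuous_on UNIV (K s)" "continuous_on UNIV (K' s)" for s
    unfolding K_def[abs_def] K'_def[abs_def] S_def S'_def a_def b_def
    by (intro continuous_intros continuous_on_compose2[OF cont(1) contW] continuous_on_compose2[OF cont(2) contW]
        continuous_on_compose2[OF cont(3) contW]; simp)+
  have "(\<integral>c. K' 0 c \<partial>M) = 0"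
  \<comment> \<open>Crude bounds suffice: \<open>S\<close> is at most 1 + 2 + 2 = 5 in absolute
    value, its first and second derivatives at most 4.\<close>
  proof (rule integral_derivative_eq_0[where K = K and C = "real m * 16 * 5 ^ (m - 1) + 4 * 5 ^ m"])
    show "((\<lambda>s. K s c) has_real_derivative K' s c) (at s)" for s c
      unfolding K_def K'_def S_def S'_def
      by (rule derivative_eq_intros refl)+ (simp add: power2_eq_square algebra_simps)
    show "\<bar>K' s c\<bar> \<le> real m * 16 * 5 ^ (m - 1) + 4 * 5 ^ m" if "c \<in> SU2" for s c
    proof -
      have "\<bar>S' s (W c)\<bar>\<^sup>2 \<le> 4\<^sup>2" using S'b[OF W[OF that], of s] by (intro power_mono) auto
      then have "\<bar>real m * (S' s (W c))\<^sup>2 * S s (W c) ^ (m - 1)\<bar> \<le> real m * 16 * 5 ^ (m - 1)"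
        unfolding abs_mult power_abs by (intro mult_mono Spow W that) auto
      moreover have "\<bar>(a (W c) * cos s + b (W c) * sin s) * S s (W c) ^ m\<bar> \<le> 4 * 5 ^ m"
        unfolding abs_mult power_abs by (intro mult_mono Spow S''b W that) auto
      ultimately show ?thesis unfolding K'_def by linarith
    qed
    show "integrable M (K s)" for s
    proof (rule integrable_const_bound[where B = "4 * 5 ^ m"])
      show "K s \<in> borel_measurable M" using contK by (intro borel_measurable_continuous)
      show "AE c in M. norm (K s c) \<le> 4 * 5 ^ m"
        unfolding K_def real_norm_def abs_mult power_abs
        by (intro AE_I2 mult_mono Spow S'b W) auto
    qed
    show "K' 0 \<in> borel_measurable M" using contK by (intro borel_measurable_continuous)
    show "(\<integral>c. K s c \<partial>M) = (\<integral>c. K 0 c \<partial>M)" for s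
    proof -
      obtain g where g: "g \<in> SU2" and gZ: "\<And>Z. Z \<in> SU2 \<Longrightarrow>
          \<alpha> (g ** Z ** ctrans g) = \<alpha> Z \<and>
          \<beta> (g ** Z ** ctrans g) = \<beta> Z * cos s - \<gamma> Z * sin s \<and>
          \<gamma> (g ** Z ** ctrans g) = \<beta> Z * sin s + \<gamma> Z * cos s"
        using rot unfolding rotates_def by metis
      \<comment> \<open>Translating \<open>c\<close> by \<open>g\<close> conjugates
        \<open>W c\<close> by \<open>g\<close>, which shifts the angle from 0 to
        \<open>s\<close>.\<close>
      have "(\<integral>c. K 0 c \<partial>M) = (\<integral>c. K 0 (g ** c) \<partial>M)"
        using contK by (intro integral_left[OF g, symmetric] borel_measurable_continuous)
      also have "\<dots> = (\<integral>c. K s c \<partial>M)"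
      proof (rule Bochner_Integration.integral_cong[OF refl])
        fix c assume "c \<in> space M"
        then have Wc: "W c \<in> SU2" using W by simp
        have "W (g ** c) = g ** W c ** ctrans g"
          by (simp add: W_def ctrans_mult matrix_mul_assoc)
        then have e: "\<alpha> (W (g ** c)) = \<alpha> (W c)"
          "\<beta> (W (g ** c)) = \<beta> (W c) * cos s - \<gamma> (W c) * sin s"
          "\<gamma> (W (g ** c)) = \<beta> (W c) * sin s + \<gamma> (W c) * cos s"
          using gZ[OF Wc] by simp_all
        have "S' 0 (W (g ** c)) = S' s (W c)" "S 0 (W (g ** c)) = S s (W c)"
          by (simp_all add: S_def S'_def a_def b_def e algebra_simps)
        then show "K 0 (g ** c) = K s c" by (simp add: K_def)
      qed
      finally show ?thesis by simp
    qed
  qed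
  then show ?thesis by (simp add: K'_def S_def S'_def T a_def b_def W_def add.assoc)
qed

text \<open>Summed over the three axes, the second derivatives are those of the Laplacian of the sphere:
  \<open>T\<close> is a linear function on a sphere, and this recursion says that its distribution
  is uniform on \<open>[-B, B]\<close> (Archimedes).\<close>

context
  fixes x y :: mat2 and T :: "mat2 \<Rightarrow> real" and B :: real
  assumes x: "x \<in> SU2" and y: "y \<in> SU2"
  defines "T \<equiv> \<lambda>c. Re (x$1$1) * Re (y$1$1) - Re ((c ** y ** ctrans c ** x)$1$1)"
  assumes B: "B\<^sup>2 = (1 - (Re (x$1$1))\<^sup>2) * (1 - (Re (y$1$1))\<^sup>2)"
begin

text \<open>\<open>T c\<close> is the inner product of the imaginary parts of \<open>x\<close> and
  of \<open>c ** y ** ctrans c\<close>, and \<open>B^2\<close> is the product of their squared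
  lengths. The second claim is then Lagrange's identity: the squared length of the cross product is
  \<open>B^2\<close> minus the squared inner product.\<close>

lemma moment_aux:
  defines "z1 \<equiv> \<lambda>c. Im ((c ** y ** ctrans c)$1$1)" and "z2 \<equiv> \<lambda>c. Re ((c ** y ** ctrans c)$1$2)"
    and "z3 \<equiv> \<lambda>c. Im ((c ** y ** ctrans c)$1$2)"
  assumes c: "c \<in> SU2"
  shows "T c = Im (x$1$1) * z1 c + Re (x$1$2) * z2 c + Im (x$1$2) * z3 c"
    and "(Im (x$1$2) * z2 c - Re (x$1$2) * z3 c)\<^sup>2 + (Im (x$1$1) * z3 c - Im (x$1$2) * z1 c)\<^sup>2
      + (Re (x$1$2) * z1 c - Im (x$1$1) * z2 c)\<^sup>2 = B\<^sup>2 - (T c)\<^sup>2"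
proof -
  have W: "c ** y ** ctrans c \<in> SU2" using c y by simp
  show T: "T c = Im (x$1$1) * z1 c + Re (x$1$2) * z2 c + Im (x$1$2) * z3 c"
    unfolding T_def SU2_Re_mult[OF W x] SU2_Re_conj[OF c y] z1_def z2_def z3_def
    by (simp add: algebra_simps)
  have "(z1 c)\<^sup>2 + (z2 c)\<^sup>2 + (z3 c)\<^sup>2 = 1 - (Re (y$1$1))\<^sup>2"
    using SU2_coords_sq_sum[OF W] unfolding SU2_Re_conj[OF c y] z1_def z2_def z3_def by linarith
  moreover have "(Im (x$1$1))\<^sup>2 + (Re (x$1$2))\<^sup>2 + (Im (x$1$2))\<^sup>2 = 1 - (Re (x$1$1))\<^sup>2"
    using SU2_coords_sq_sum[OF x] by linarith
  ultimately show "(Im (x$1$2) * z2 c - Re (x$1$2) * z3 c)\<^sup>2 + (Im (x$1$1) * z3 c - Im (x$1$2) * z1 c)\<^sup>2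
      + (Re (x$1$2) * z1 c - Im (x$1$1) * z2 c)\<^sup>2 = B\<^sup>2 - (T c)\<^sup>2"
    unfolding T using B by algebra
qed

lemma abs_T_le:
  assumes "c \<in> SU2"
  shows "\<bar>T c\<bar> \<le> \<bar>B\<bar>"
proof -
  have "(T c)\<^sup>2 \<le> B\<^sup>2"
    using moment_aux(2)[OF assms] by (smt (verit) zero_le_power2)
  then show ?thesis by (simp add: abs_le_square_iff)
qed

lemma continuous_T: "continuous_on UNIV T"
  unfolding T_def by (intro continuous_intros continuous_on_component)

lemma integrable_T_power: "integrable M (\<lambda>c. T c ^ n)"
proof (rule integrable_const_bound[where B = "\<bar>B\<bar> ^ n"])
  show "(\<lambda>c. T c ^ n) \<in> borel_measurable M"
    by (intro borel_measurable_continuous continuous_intros continuous_T)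
  show "AE c in M. norm (T c ^ n) \<le> \<bar>B\<bar> ^ n"
    using abs_T_le by (intro AE_I2) (simp add: power_abs power_mono)
qed

lemma moment_rec: "real (m + 2) * (\<integral>c. T c ^ (m + 1) \<partial>M) = real m * B\<^sup>2 * (\<integral>c. T c ^ (m - 1) \<partial>M)"
proof -
  define z1 z2 z3 where "z1 Z = Im (Z$1$1)" and "z2 Z = Re (Z$1$2)" and "z3 Z = Im (Z$1$2)" for Z :: mat2
  define w where "w c = c ** y ** ctrans c" for c
  have cont: "continuous_on UNIV z1" "continuous_on UNIV z2" "continuous_on UNIV z3"
    unfolding z1_def[abs_def] z2_def[abs_def] z3_def[abs_def]
    by (intro continuous_intros continuous_on_component)+
  have contw: "continuous_on UNIV w" unfolding w_def[abs_def] by (intro continuous_intros)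
  have bd: "\<bar>z1 Z\<bar> \<le> 1" "\<bar>z2 Z\<bar> \<le> 1" "\<bar>z3 Z\<bar> \<le> 1" if "Z \<in> SU2" for Z
    using SU2_coords_le_1[OF that] by (simp_all add: z1_def z2_def z3_def)
  define L where "L Z = z1 x * z1 Z + z2 x * z2 Z + z3 x * z3 Z" for Z
  note rot = rotates_coords[folded z1_def[abs_def] z2_def[abs_def] z3_def[abs_def]]
  define F where "F u1 u2 v1 v2 c = real m * (u2 * v1 (w c) - u1 * v2 (w c))\<^sup>2 * L (w c) ^ (m - 1)
      - (u1 * v1 (w c) + u2 * v2 (w c)) * L (w c) ^ m" for u1 u2 v1 v2 c
  have F0: "(\<integral>c. F (z2 x) (z3 x) z2 z3 c \<partial>M) = 0" "(\<integral>c. F (z3 x) (z1 x) z3 z1 c \<partial>M) = 0"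
    "(\<integral>c. F (z1 x) (z2 x) z1 z2 c \<partial>M) = 0"
    unfolding F_def w_def
    by (rule rotation_moment[OF rot(1) y cont(1,2,3) bd(1,2,3) bd(1,2,3)[OF x]], assumption+, simp add: L_def)
       (rule rotation_moment[OF rot(2) y cont(2,3,1) bd(2,3,1) bd(2,3,1)[OF x]], assumption+, simp add: L_def,
        rule rotation_moment[OF rot(3) y cont(3,1,2) bd(3,1,2) bd(3,1,2)[OF x]], assumption+, simp add: L_def)
  have Tw: "L (w c) = T c" "(z3 x * z2 (w c) - z2 x * z3 (w c))\<^sup>2 + (z1 x * z3 (w c) - z3 x * z1 (w c))\<^sup>2
      + (z2 x * z1 (w c) - z1 x * z2 (w c))\<^sup>2 = B\<^sup>2 - (T c)\<^sup>2" if "c \<in> SU2" for c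
    using moment_aux[OF that] by (simp_all add: L_def z1_def z2_def z3_def w_def)
  have sumF: "F (z2 x) (z3 x) z2 z3 c + F (z3 x) (z1 x) z3 z1 c + F (z1 x) (z2 x) z1 z2 c
     = real m * B\<^sup>2 * T c ^ (m - 1) - real (m + 2) * T c ^ (m + 1)" if c: "c \<in> SU2" for c
  proof -
    \<comment> \<open>Each term of the inner product \<open>L\<close> occurs for two of the three
      axes, hence \<open>2 * L\<close>; the squares are the components of the cross product.\<close>
    have "F (z2 x) (z3 x) z2 z3 c + F (z3 x) (z1 x) z3 z1 c + F (z1 x) (z2 x) z1 z2 c
      = real m * ((z3 x * z2 (w c) - z2 x * z3 (w c))\<^sup>2 + (z1 x * z3 (w c) - z3 x * z1 (w c))\<^sup>2
      + (z2 x * z1 (w c) - z1 x * z2 (w c))\<^sup>2) * L (w c) ^ (m - 1) - 2 * L (w c) * L (w c) ^ m"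
      by (simp add: F_def L_def algebra_simps)
    also have "\<dots> = real m * (B\<^sup>2 - (T c)\<^sup>2) * T c ^ (m - 1) - 2 * T c * T c ^ m"
      by (simp only: Tw[OF c])
    also have "\<dots> = real m * B\<^sup>2 * T c ^ (m - 1) - real (m + 2) * T c ^ (m + 1)"
      \<comment> \<open>For \<open>m = 0\<close> the exponent \<open>m - 1\<close> is truncated, but
        its coefficient vanishes.\<close>
      by (cases m) (simp_all add: algebra_simps power2_eq_square)
    finally show ?thesis .
  qed
  have contF: "continuous_on UNIV (F u1 u2 v1 v2)" if "continuous_on UNIV v1" "continuous_on UNIV v2" for u1 u2 v1 v2
    unfolding F_def[abs_def] L_def
    by (intro continuous_intros continuous_on_compose2[OF that(1) contw] continuous_on_compose2[OF that(2) contw]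
        continuous_on_compose2[OF cont(1) contw] continuous_on_compose2[OF cont(2) contw]
        continuous_on_compose2[OF cont(3) contw]; simp)
  have intF: "integrable M (F u1 u2 v1 v2)"
    if v: "continuous_on UNIV v1" "continuous_on UNIV v2"
      "\<And>Z. Z \<in> SU2 \<Longrightarrow> \<bar>v1 Z\<bar> \<le> 1" "\<And>Z. Z \<in> SU2 \<Longrightarrow> \<bar>v2 Z\<bar> \<le> 1"
      and u: "\<bar>u1\<bar> \<le> 1" "\<bar>u2\<bar> \<le> 1" for u1 u2 v1 v2
  proof (rule integrable_const_bound[where B = "real m * 2\<^sup>2 * \<bar>B\<bar> ^ (m - 1) + 2 * \<bar>B\<bar> ^ m"])
    show "F u1 u2 v1 v2 \<in> borel_measurable M" using contF[OF v(1,2)] by (intro borel_measurable_continuous)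
    have "norm (F u1 u2 v1 v2 c) \<le> real m * 2\<^sup>2 * \<bar>B\<bar> ^ (m - 1) + 2 * \<bar>B\<bar> ^ m" if c: "c \<in> SU2" for c
    proof -
      have wc: "w c \<in> SU2" using c y by (simp add: w_def)
      have prod1: "\<bar>p * q\<bar> \<le> 1" if "\<bar>p\<bar> \<le> 1" "\<bar>q\<bar> \<le> 1" for p q :: real
        using mult_mono[of "\<bar>p\<bar>" 1 "\<bar>q\<bar>" 1] that by (simp add: abs_mult)
      have 1: "\<bar>u2 * v1 (w c) - u1 * v2 (w c)\<bar> \<le> 2"
        using prod1[OF u(2) v(3)[OF wc]] prod1[OF u(1) v(4)[OF wc]] by linarith
      have 2: "\<bar>u1 * v1 (w c) + u2 * v2 (w c)\<bar> \<le> 2"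
        using prod1[OF u(1) v(3)[OF wc]] prod1[OF u(2) v(4)[OF wc]] by linarith
      have T: "\<bar>T c\<bar> ^ n \<le> \<bar>B\<bar> ^ n" for n using abs_T_le[OF c] by (intro power_mono) auto
      have "\<bar>u2 * v1 (w c) - u1 * v2 (w c)\<bar>\<^sup>2 \<le> 2\<^sup>2" using 1 by (intro power_mono) auto
      then have "\<bar>real m * (u2 * v1 (w c) - u1 * v2 (w c))\<^sup>2 * T c ^ (m - 1)\<bar> \<le> real m * 2\<^sup>2 * \<bar>B\<bar> ^ (m - 1)"
        unfolding abs_mult power_abs by (intro mult_mono T) auto
      moreover have "\<bar>(u1 * v1 (w c) + u2 * v2 (w c)) * T c ^ m\<bar> \<le> 2 * \<bar>B\<bar> ^ m"
        unfolding abs_mult power_abs by (intro mult_mono T 2) auto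
      ultimately show ?thesis unfolding F_def Tw(1)[OF c] real_norm_def by linarith
    qed
    then show "AE c in M. norm (F u1 u2 v1 v2 c) \<le> real m * 2\<^sup>2 * \<bar>B\<bar> ^ (m - 1) + 2 * \<bar>B\<bar> ^ m"
      by (intro AE_I2) simp
  qed
  have "0 = (\<integral>c. F (z2 x) (z3 x) z2 z3 c + F (z3 x) (z1 x) z3 z1 c + F (z1 x) (z2 x) z1 z2 c \<partial>M)"
    using F0 intF cont bd bd[OF x] by simp
  also have "\<dots> = (\<integral>c. real m * B\<^sup>2 * T c ^ (m - 1) - real (m + 2) * T c ^ (m + 1) \<partial>M)"
    using sumF by (intro Bochner_Integration.integral_cong) auto
  also have "\<dots> = real m * B\<^sup>2 * (\<integral>c. T c ^ (m - 1) \<partial>M) - real (m + 2) * (\<integral>c. T c ^ (m + 1) \<partial>M)"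
    by (simp add: integrable_T_power del: power_Suc of_nat_add)
  finally show ?thesis by simp
qed

text \<open>These are the moments of the uniform law on [-B, B], multiplied out so that
  \<open>B = 0\<close> and \<open>m = 0\<close> are included. \<open>moment_rec\<close> lowers
  \<open>m\<close> by two, which leaves two base cases.\<close>

lemma moment: "2 * B * (real m * (\<integral>c. T c ^ (m - 1) \<partial>M)) = B ^ m - (- B) ^ m"
proof (induction m rule: less_induct)
  case (less m)
  consider "m = 0" | "m = 1" | n where "m = n + 2"
    by (metis add_2_eq_Suc' not0_implies_Suc One_nat_def)
  then show ?case
  proof cases
    case 3
    have "2 * B * (real m * (\<integral>c. T c ^ (m - 1) \<partial>M)) = B\<^sup>2 * (2 * B * (real n * (\<integral>c. T c ^ (n - 1) \<partial>M)))"
      using moment_rec[of n] 3 by (simp add: algebra_simps)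
    also have "\<dots> = B\<^sup>2 * (B ^ n - (- B) ^ n)"
      using less[of n] 3 by simp
    finally show ?thesis using 3 by (simp add: algebra_simps power2_eq_square)
  qed simp_all
qed

text \<open>The fundamental theorem of calculus for the uniform law, monomial by monomial; no
  density of \<open>T\<close> has to be determined.\<close>

lemma integral_poly_pderiv:
  "2 * B * (\<integral>c. poly (pderiv p) (T c) \<partial>M) = poly p B - poly p (- B)"
proof -
  have p: "p = (\<Sum>i\<le>degree p. monom (coeff p i) i)"
    by (simp add: poly_as_sum_of_monoms)
  have "poly (pderiv p) t = (\<Sum>i\<le>degree p. coeff p i * (real i * t ^ (i - 1)))" for t
    by (subst p) (simp add: higher_pderiv_sum[of 1, simplified] pderiv_monom poly_sum poly_monom mult_ac)
  then have "2 * B * (\<integral>c. poly (pderiv p) (T c) \<partial>M)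
      = (\<Sum>i\<le>degree p. coeff p i * (2 * B * (real i * (\<integral>c. T c ^ (i - 1) \<partial>M))))"
    by (simp add: integrable_T_power sum_distrib_left mult_ac)
  also have "\<dots> = (\<Sum>i\<le>degree p. coeff p i * (B ^ i - (- B) ^ i))"
    by (simp only: moment)
  also have "\<dots> = poly p B - poly p (- B)"
    by (simp add: poly_altdef sum_subtractf right_diff_distrib)
  finally show ?thesis .
qed

end

end

subsection \<open>The approximate diagonal\<close>

text \<open>On \<open>SU2\<close>, \<open>Re (x$1$1)\<close> is half the trace, hence
  \<open>cos \<theta>\<close> when the eigenvalues are \<open>exp (i * \<theta>)\<close> and
  \<open>exp (- i * \<theta>)\<close>.\<close>

definition sph_real :: "nat \<Rightarrow> mat2 \<Rightarrow> real" where
  "sph_real k x = poly (sph_poly k) (Re (x$1$1))"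

definition sph :: "nat \<Rightarrow> fn" where
  "sph k x = complex_of_real (sph_real k x)"

lemma continuous_sph_real: "continuous_on UNIV (sph_real k)"
  unfolding sph_real_def [abs_def] by (intro continuous_intros continuous_on_component)

lemma continuous_sph: "continuous_on UNIV (sph k)"
  unfolding sph_def [abs_def] by (intro continuous_intros continuous_sph_real)

lemma norm_sph_le_1: "x \<in> SU2 \<Longrightarrow> norm (sph k x) \<le> 1"
  by (simp add: sph_def sph_real_def abs_sph_poly_le_1 SU2_coords_le_1)

lemma sph_class: "x \<in> SU2 \<Longrightarrow> y \<in> SU2 \<Longrightarrow> sph k (x ** y) = sph k (y ** x)"
  unfolding sph_def sph_real_def by (subst SU2_Re_mult_commute) simp_all

lemma sph_one: "sph k (mat 1) = 1"
  by (simp add: sph_def sph_real_def mat_def poly_sph_poly_1)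

text \<open>At \<open>\<theta> = pi / (2 * 3 ^ k)\<close> the numerators
  \<open>sin (3 ^ k * \<theta>)\<close> and \<open>sin (3 ^ Suc k * \<theta>)\<close> are 1 and -1,
  so the two characters have opposite signs.\<close>

lemma ex_sph_neq: "\<exists>x\<in>SU2. sph k x \<noteq> sph (Suc k) x"
proof
  define \<theta> where "\<theta> = pi / (2 * 3 ^ k)"
  have \<theta>: "3 ^ k * \<theta> = pi / 2" by (simp add: \<theta>_def)
  have 1: "3 ^ k * poly (sph_poly k) (cos \<theta>) * sin \<theta> = 1"
    by (simp only: sph_poly_cos \<theta> sin_pi_half)
  have "3 ^ Suc k * \<theta> = 3/2 * pi" by (simp only: power_Suc mult.assoc \<theta>)
  then have 2: "3 ^ Suc k * poly (sph_poly (Suc k)) (cos \<theta>) * sin \<theta> = -1"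
    by (simp only: sph_poly_cos sin_3over2_pi)
  let ?x = "quat (cis \<theta>) 0"
  show "?x \<in> SU2" by (intro quat_in_SU2) (simp add: cis_cnj cis_mult)
  show "sph k ?x \<noteq> sph (Suc k) ?x"
  proof
    assume "sph k ?x = sph (Suc k) ?x"
    then have "poly (sph_poly k) (cos \<theta>) = poly (sph_poly (Suc k)) (cos \<theta>)"
      by (simp add: sph_def sph_real_def del: sph_poly.simps)
    then have "3 ^ Suc k * poly (sph_poly (Suc k)) (cos \<theta>) * sin \<theta>
        = 3 * (3 ^ k * poly (sph_poly k) (cos \<theta>) * sin \<theta>)"
      by (simp only: power_Suc mult.assoc)
    then show False unfolding 1 2 by simp
  qed
qed

section \<open>The characters as multiplicative functionals on the centre\<close>

context haar
begin

lemma sph_bmeas: "sph k \<in> bmeas"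
  using norm_sph_le_1 by (intro bmeasI[of _ 1] borel_measurable_continuous continuous_sph) auto

lemma sph_in_ZL1: "sph k \<in> ZL1 M"
  by (intro class_function_in_ZL1 sph_bmeas sph_class)

text \<open>With \<open>n = 3 ^ k\<close>, the average is that of the character over the interval
  from \<open>cos (\<theta> + \<phi>)\<close> to \<open>cos (\<theta> - \<phi>)\<close>. By
  \<open>pderiv_cheb\<close> it is the difference of \<open>cos (n * (\<theta> - \<phi>))\<close>
  and \<open>cos (n * (\<theta> + \<phi>))\<close> up to a factor, and this difference splits into
  \<open>2 * sin (n * \<theta>) * sin (n * \<phi>)\<close>.\<close>

lemma sph_functional_equation:
  assumes x: "x \<in> SU2" and y: "y \<in> SU2"
  shows "(\<integral>c. sph k (c ** y ** ctrans c ** x) \<partial>M) = sph k y * sph k x"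
proof -
  define \<theta> \<phi> where "\<theta> = arccos (Re (y$1$1))" and "\<phi> = arccos (Re (x$1$1))"
  have cos: "Re (y$1$1) = cos \<theta>" "Re (x$1$1) = cos \<phi>"
    using SU2_coords_le_1[OF x] SU2_coords_le_1[OF y] by (auto simp: \<theta>_def \<phi>_def abs_le_iff)
  define A B where "A = cos \<phi> * cos \<theta>" and "B = sin \<theta> * sin \<phi>"
  have B: "B\<^sup>2 = (1 - (Re (x$1$1))\<^sup>2) * (1 - (Re (y$1$1))\<^sup>2)"
    by (simp add: cos B_def power_mult_distrib sin_squared_eq)
  define T where "T c = Re (x$1$1) * Re (y$1$1) - Re ((c ** y ** ctrans c ** x)$1$1)" for c
  define P where "P = poly (sph_poly k)"
  have sph: "sph_real k (c ** y ** ctrans c ** x) = P (A - T c)" for c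
    by (simp add: sph_real_def P_def T_def A_def cos)
  have "(\<integral>c. P (A - T c) \<partial>M) = P (cos \<theta>) * P (cos \<phi>)"
  proof (cases "B = 0")
    case True
    \<comment> \<open>The interval degenerates: \<open>x\<close> or \<open>y\<close> is plus or
      minus the identity. The minus sign is absorbed because \<open>sph_poly k\<close> is
      even.\<close>
    then have "cos \<theta> = 1 \<or> cos \<theta> = -1 \<or> cos \<phi> = 1 \<or> cos \<phi> = -1"
      using B by (auto simp: cos power2_eq_1_iff)
    then have "P A = P (cos \<theta>) * P (cos \<phi>)"
      by (auto simp: A_def P_def poly_sph_poly_minus poly_sph_poly_1)
    moreover have "T c = 0" if "c \<in> SU2" for c
      using abs_T_le[OF x y B that] True by (simp add: T_def)
    then have "(\<integral>c. P (A - T c) \<partial>M) = (\<integral>c. P A \<partial>M)"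
      by (intro Bochner_Integration.integral_cong) auto
    ultimately show ?thesis by simp
  next
    case False
    \<comment> \<open>\<open>p\<close> is the Chebyshev polynomial at \<open>A - t\<close>; its
      arguments at \<open>t = B\<close> and \<open>t = - B\<close> are
      \<open>cos (\<theta> + \<phi>)\<close> and \<open>cos (\<theta> - \<phi>)\<close>.\<close>
    define p where "p = pcompose (cheb k) [:A, -1:]"
    have "poly (pderiv p) t = - (9 ^ k) * P (A - t)" for t
      by (simp add: p_def pderiv_pcompose pderiv_cheb pderiv_pCons poly_pcompose P_def)
    with integral_poly_pderiv[OF x y B, of p]
    have "2 * B * (9 ^ k * (\<integral>c. P (A - T c) \<partial>M)) = poly p (- B) - poly p B"
      by (simp add: T_def)
    also have "\<dots> = cos (3 ^ k * (\<theta> - \<phi>)) - cos (3 ^ k * (\<theta> + \<phi>))"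
    proof -
      have "poly p (- B) = cos (3 ^ k * (\<theta> - \<phi>))" "poly p B = cos (3 ^ k * (\<theta> + \<phi>))"
        unfolding cheb_cos[symmetric] by (simp_all add: p_def poly_pcompose A_def B_def cos_diff cos_add mult.commute)
      then show ?thesis by simp
    qed
    also have "\<dots> = 2 * sin (3 ^ k * \<theta>) * sin (3 ^ k * \<phi>)"
      by (simp add: cos_diff cos_add right_diff_distrib distrib_left)
    also have "\<dots> = 2 * (3 ^ k * P (cos \<theta>) * sin \<theta>) * (3 ^ k * P (cos \<phi>) * sin \<phi>)"
      by (simp only: P_def sph_poly_cos)
    also have "\<dots> = 2 * B * (9 ^ k * (P (cos \<theta>) * P (cos \<phi>)))"
      using power_mult_distrib[of 3 "3::real" k] by (simp add: B_def)
    finally show ?thesis using False by simp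
  qed
  then show ?thesis
    by (simp add: sph_def sph) (simp add: sph_real_def cos P_def)
qed

text \<open>Haar measure charges every nonempty open set: if \<open>f x0\<close> were nonzero, the
  translates \<open>V g\<close> of the open set where \<open>f\<close> is nonzero would be null sets
  covering \<open>SU2\<close>, and by Lindelof countably many of them suffice.\<close>

lemma continuous_AE_0_imp_0:
  fixes f :: fn
  assumes f: "continuous_on UNIV f" and AE: "AE x in M. f x = 0" and x0: "x0 \<in> SU2"
  shows "f x0 = 0"
proof (rule ccontr)
  assume nz: "f x0 \<noteq> 0"
  define V where "V g = {x. f (x0 ** ctrans g ** x) \<noteq> 0}" for g
  have "open (V g)" for g
    unfolding V_def
    by (intro open_Collect_neq continuous_on_compose2[OF f] continuous_intros) auto
  then have opens: "\<And>S. S \<in> V ` SU2 \<Longrightarrow> open S" by auto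
  obtain \<D> where \<D>: "\<D> \<subseteq> V ` SU2" "countable \<D>" "\<Union>\<D> = \<Union>(V ` SU2)"
    by (rule Lindelof[OF opens])
  have "AE x in M. \<forall>D\<in>\<D>. x \<notin> D"
    unfolding AE_ball_countable[OF \<D>(2)]
  proof
    fix D assume "D \<in> \<D>"
    then obtain g where g: "g \<in> SU2" "D = V g" using \<D>(1) by blast
    have h: "x0 ** ctrans g \<in> SU2" using g x0 by simp
    have "AE x in distr M M (\<lambda>x. x0 ** ctrans g ** x). f x = 0"
      using AE by (simp only: distr_left[OF h])
    then show "AE x in M. x \<notin> D"
      using AE_distrD[OF measurable_left[OF h]] by (simp add: g V_def)
  qed
  moreover have "\<exists>D\<in>\<D>. x \<in> D" if "x \<in> SU2" for x
  proof -
    have "x \<in> V x"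
      using that nz by (simp add: V_def SU2_ctrans_mult flip: matrix_mul_assoc)
    then have "x \<in> \<Union>\<D>" unfolding \<D>(3) using that by blast
    then show ?thesis by blast
  qed
  then have "AE x in M. (\<forall>D\<in>\<D>. x \<notin> D) \<longrightarrow> False"
    by (intro AE_I2) auto
  ultimately have "AE x in M. False" by (rule AE_mp)
  then have "emeasure M (space M) = 0" by (simp only: eventually_False ae_filter_eq_bot_iff)
  then show False by (simp add: emeasure_space_1)
qed

lemma integral_square_neq_0:
  fixes r :: "mat2 \<Rightarrow> real"
  assumes r: "continuous_on UNIV r" and bd: "\<And>x. x \<in> SU2 \<Longrightarrow> \<bar>r x\<bar> \<le> C"
    and x0: "x0 \<in> SU2" "r x0 \<noteq> 0"
  shows "(\<integral>x. complex_of_real (r x) * complex_of_real (r x) \<partial>M) \<noteq> 0"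
proof
  assume "(\<integral>x. complex_of_real (r x) * complex_of_real (r x) \<partial>M) = 0"
  then have 0: "(\<integral>x. r x * r x \<partial>M) = 0" by (simp flip: of_real_mult)
  have "integrable M (\<lambda>x. r x * r x)"
  proof (rule integrable_const_bound[where B = "C * C"])
    show "AE x in M. norm (r x * r x) \<le> C * C"
    proof (rule AE_I2)
      fix x assume "x \<in> space M"
      then show "norm (r x * r x) \<le> C * C"
        using mult_mono[OF bd bd, of x x] bd[of x] unfolding real_norm_def abs_mult by simp
    qed
  qed (intro borel_measurable_continuous continuous_intros r)
  then have "AE x in M. r x * r x = 0"
    using 0 by (subst (asm) integral_nonneg_eq_0_iff_AE) auto
  then have "AE x in M. complex_of_real (r x) = 0" by simp
  then show False
    using continuous_AE_0_imp_0[of "\<lambda>x. complex_of_real (r x)" x0] r x0 by (simp add: continuous_on_of_real)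
qed

definition Phi :: "nat \<Rightarrow> fn \<Rightarrow> complex" where
  "Phi k f = (\<integral>x. f x * sph k x \<partial>M)"

lemma Phi_conv: "f \<in> ZL1 M \<Longrightarrow> integrable M g \<Longrightarrow> Phi k (conv M f g) = Phi k f * Phi k g"
  unfolding Phi_def by (rule spherical_multiplicative[OF _ _ sph_bmeas sph_functional_equation])

lemma norm_Phi_le: "integrable M f \<Longrightarrow> norm (Phi k f) \<le> L1norm M f"
  using norm_integral_mult_le[of f "sph k" 1] norm_sph_le_1 bmeas_measurable[OF sph_bmeas]
  by (simp add: Phi_def)

lemma Phi_diff:
  "integrable M f \<Longrightarrow> integrable M g \<Longrightarrow> Phi k (\<lambda>x. f x - g x) = Phi k f - Phi k g"
  using integrable_mult_bmeas[OF _ sph_bmeas] by (simp add: Phi_def left_diff_distrib)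

lemma Phi_sum:
  "(\<And>i. i \<in> I \<Longrightarrow> integrable M (f i)) \<Longrightarrow> Phi k (\<lambda>x. \<Sum>i\<in>I. f i x) = (\<Sum>i\<in>I. Phi k (f i))"
  using integrable_mult_bmeas[OF _ sph_bmeas] by (simp add: Phi_def sum_distrib_right)

lemma ex_Phi_neq_0: "\<exists>a\<in>ZL1 M. Phi k a \<noteq> 0"
  using integral_square_neq_0[of "sph_real k" 1 "mat 1"] norm_sph_le_1 SU2_one sph_one[of k]
  by (intro bexI[of _ "sph k"] sph_in_ZL1) (simp add: Phi_def continuous_sph_real sph_def)

section \<open>The differences \<open>psi k\<close> and the test forms\<close>

definition psi :: "nat \<Rightarrow> fn" where
  "psi k x = sph k x - sph (Suc k) x"

lemma norm_psi_le: "x \<in> SU2 \<Longrightarrow> norm (psi k x) \<le> 2"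
  using norm_triangle_ineq4[of "sph k x" "sph (Suc k) x"] norm_sph_le_1[of x k] norm_sph_le_1[of x "Suc k"]
  by (simp add: psi_def)

lemma psi_bmeas: "psi k \<in> bmeas"
  using norm_psi_le unfolding psi_def [abs_def]
  by (intro bmeasI[of _ 2] borel_measurable_continuous continuous_intros continuous_sph) auto

lemma psi_in_ZL1: "psi k \<in> ZL1 M"
  by (intro class_function_in_ZL1 psi_bmeas) (simp add: psi_def sph_class)

lemma integral_mult_psi: "integrable M f \<Longrightarrow> (\<integral>x. f x * psi k x \<partial>M) = Phi k f - Phi (Suc k) f"
  using integrable_mult_bmeas[OF _ sph_bmeas] by (simp add: Phi_def psi_def right_diff_distrib)

text \<open>The difference of the two sides is the integral of \<open>psi k\<close> squared, which
  is nonzero as \<open>psi k\<close> is real-valued, continuous and not identically 0 on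
  \<open>SU2\<close>.\<close>

lemma Phi_psi_neq: "Phi k (psi k) \<noteq> Phi (Suc k) (psi k)"
proof -
  obtain x where x: "x \<in> SU2" "sph k x \<noteq> sph (Suc k) x" using ex_sph_neq by blast
  have "psi k = (\<lambda>x. complex_of_real (sph_real k x - sph_real (Suc k) x))"
    by (simp add: psi_def sph_def fun_eq_iff)
  moreover from this have "\<bar>sph_real k x - sph_real (Suc k) x\<bar> \<le> 2" if "x \<in> SU2" for x
    using norm_psi_le[OF that, of k] by (simp del: of_real_diff)
  ultimately have "(\<integral>z. psi k z * psi k z \<partial>M) \<noteq> 0"
    using integral_square_neq_0[of "\<lambda>x. sph_real k x - sph_real (Suc k) x" 2 x] x
    by (simp add: continuous_on_diff continuous_sph_real sph_def del: of_real_diff)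
  then show ?thesis
    using integral_mult_psi[OF bmeas_integrable[OF psi_bmeas], of k k] by auto
qed

text \<open>The factor 1/2 normalises the kernel: \<open>|a * b| / 2 <= (|a|^2 + |b|^2) / 4\<close>
  termwise, and either sum of squares is at most 2, whatever \<open>K\<close> is.\<close>

lemma norm_sum_psi_le:
  assumes "x \<in> SU2" "y \<in> SU2"
  shows "norm (\<Sum>k<K. psi k x / 2 * psi k y) \<le> 1"
proof -
  have sq: "(\<Sum>k<K. (norm (psi k z))\<^sup>2) \<le> 2" if "z \<in> SU2" for z
    using sum_sph_poly_diff_sq_le[OF SU2_coords_le_1(1)[OF that], of K]
    by (simp add: psi_def sph_def sph_real_def del: sph_poly.simps flip: of_real_diff)
  have "norm (\<Sum>k<K. psi k x / 2 * psi k y) \<le> (\<Sum>k<K. ((norm (psi k x))\<^sup>2 + (norm (psi k y))\<^sup>2) / 4)"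
  proof (rule sum_norm_le)
    fix k
    have "2 * (norm (psi k x) * norm (psi k y)) \<le> (norm (psi k x))\<^sup>2 + (norm (psi k y))\<^sup>2"
      using sum_squares_bound[of "norm (psi k x)" "norm (psi k y)"] by simp
    then show "norm (psi k x / 2 * psi k y) \<le> ((norm (psi k x))\<^sup>2 + (norm (psi k y))\<^sup>2) / 4"
      by (simp add: norm_mult norm_divide)
  qed
  also have "\<dots> = ((\<Sum>k<K. (norm (psi k x))\<^sup>2) + (\<Sum>k<K. (norm (psi k y))\<^sup>2)) / 4"
    by (simp add: sum.distrib flip: sum_divide_distrib)
  also have "\<dots> \<le> 1" using sq[OF assms(1)] sq[OF assms(2)] by simp
  finally show ?thesis .
qed

text \<open>The norm of the form is at most the supremum of the kernel on \<open>SU2\<close> x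
  \<open>SU2\<close>: integrate against \<open>g\<close> first, then against \<open>f\<close>. The
  kernel is estimated as a whole, since bounding its terms one by one would lose the independence of
  \<open>K\<close>.\<close>

lemma tensor_bilin1:
  assumes q: "\<And>k. q k \<in> bmeas" and r: "\<And>k. r k \<in> bmeas"
    and bound: "\<And>x y. x \<in> SU2 \<Longrightarrow> y \<in> SU2 \<Longrightarrow> norm (\<Sum>k<K. q k x * r k y) \<le> 1"
  shows "(\<lambda>f g. \<Sum>k<(K::nat). (\<integral>x. f x * q k x \<partial>M) * (\<integral>y. g y * r k y \<partial>M)) \<in> bilin1 M"
proof -
  have bd: "norm (\<Sum>k<K. (\<integral>x. f x * q k x \<partial>M) * (\<integral>y. g y * r k y \<partial>M)) \<le> L1norm M f * L1norm M g"
    if f: "integrable M f" and g: "integrable M g" for f g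
  proof -
    define h where "h x = (\<Sum>k<K. q k x * (\<integral>y. g y * r k y \<partial>M))" for x
    have "h x = (\<integral>y. g y * (\<Sum>k<K. q k x * r k y) \<partial>M)" for x
      using integrable_mult_bmeas[OF g r]
      by (simp add: h_def sum_distrib_left mult.left_commute[of _ "q _ x"])
    then have h: "norm (h x) \<le> L1norm M g" if "x \<in> SU2" for x
      using norm_integral_mult_le[OF g, of "\<lambda>y. \<Sum>k<K. q k x * r k y" 1] bound[OF that]
        bmeas_measurable[OF r] by simp
    have "(\<Sum>k<K. (\<integral>x. f x * q k x \<partial>M) * (\<integral>y. g y * r k y \<partial>M)) = (\<integral>x. f x * h x \<partial>M)"
      using integrable_mult_bmeas[OF f q] by (simp add: h_def sum_distrib_left flip: mult.assoc)
    also have "norm \<dots> \<le> L1norm M g * L1norm M f"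
      using h bmeas_measurable[OF q] by (intro norm_integral_mult_le f) (auto simp: h_def[abs_def])
    finally show ?thesis by (simp add: mult.commute)
  qed
  have lin: "(\<integral>x. (f1 x + f2 x) * p x \<partial>M) = (\<integral>x. f1 x * p x \<partial>M) + (\<integral>x. f2 x * p x \<partial>M)"
    if "f1 \<in> ZL1 M" "f2 \<in> ZL1 M" "p \<in> bmeas" for f1 f2 p
    using that integrable_mult_bmeas ZL1_integrable by (simp add: distrib_right)
  have scale: "(\<integral>x. (c * f x) * p x \<partial>M) = c * (\<integral>x. f x * p x \<partial>M)" for c f and p :: fn
    by (simp add: mult.assoc)
  show ?thesis
    unfolding bilin1_def mem_Collect_eq
  proof (intro conjI ballI allI)
    fix f1 f2 g assume z: "f1 \<in> ZL1 M" "f2 \<in> ZL1 M" "g \<in> ZL1 M"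
    show "(\<Sum>k<K. (\<integral>x. (f1 x + f2 x) * q k x \<partial>M) * (\<integral>y. g y * r k y \<partial>M))
        = (\<Sum>k<K. (\<integral>x. f1 x * q k x \<partial>M) * (\<integral>y. g y * r k y \<partial>M))
        + (\<Sum>k<K. (\<integral>x. f2 x * q k x \<partial>M) * (\<integral>y. g y * r k y \<partial>M))"
      by (simp only: lin[OF z(1,2) q]) (simp only: distrib_right sum.distrib)
    show "(\<Sum>k<K. (\<integral>x. g x * q k x \<partial>M) * (\<integral>y. (f1 y + f2 y) * r k y \<partial>M))
        = (\<Sum>k<K. (\<integral>x. g x * q k x \<partial>M) * (\<integral>y. f1 y * r k y \<partial>M))
        + (\<Sum>k<K. (\<integral>x. g x * q k x \<partial>M) * (\<integral>y. f2 y * r k y \<partial>M))"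
      by (simp only: lin[OF z(1,2) r]) (simp only: distrib_left sum.distrib)
  qed (simp_all only: scale, auto simp: sum_distrib_left mult_ac intro!: bd ZL1_integrable)
qed

lemma Phi_tensor_bilin1: "(\<lambda>f g. Phi k f * Phi l g) \<in> bilin1 M"
proof -
  have "norm (sph k x * sph l y) \<le> 1" if "x \<in> SU2" "y \<in> SU2" for x y
    using mult_mono[OF norm_sph_le_1[OF that(1), of k] norm_sph_le_1[OF that(2), of l]] by (simp add: norm_mult)
  then show ?thesis
    using tensor_bilin1[of "\<lambda>_. sph k" "\<lambda>_. sph l" "Suc 0"] by (simp add: sph_bmeas Phi_def)
qed

lemma psi_tensor_bilin1:
  "(\<lambda>f g. \<Sum>k<K. (\<integral>x. f x * (psi k x / 2) \<partial>M) * (\<integral>y. g y * psi k y \<partial>M)) \<in> bilin1 M"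
proof (rule tensor_bilin1)
  show "(\<lambda>x. psi k x / 2) \<in> bmeas" for k
    using norm_psi_le[of _ k] bmeas_measurable[OF psi_bmeas, of k]
    by (intro bmeasI[of _ 1]) (simp_all add: norm_divide)
qed (intro psi_bmeas norm_sum_psi_le; assumption)+

section \<open>The contradiction\<close>

lemma bilin1_bound: "B \<in> bilin1 M \<Longrightarrow> f \<in> ZL1 M \<Longrightarrow> g \<in> ZL1 M \<Longrightarrow> norm (B f g) \<le> L1norm M f * L1norm M g"
  by (simp add: bilin1_def)

lemma L1norm_nonneg: "0 \<le> L1norm M f"
  by (simp add: L1norm_def)

text \<open>Used with \<open>L = 1\<close> for the pairing of a form with the diagonal itself, and
  with \<open>L = L1norm M a\<close> after multiplication of one leg by \<open>a\<close>.\<close>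

lemma series_bound:
  fixes s t :: "nat \<Rightarrow> fn" and b :: "nat \<Rightarrow> complex"
  assumes sum: "summable (\<lambda>n. L1norm M (s n) * L1norm M (t n))"
    and C: "(\<Sum>n. L1norm M (s n) * L1norm M (t n)) \<le> C" and L: "0 \<le> L"
    and b: "\<And>n. norm (b n) \<le> L * (L1norm M (s n) * L1norm M (t n))"
  shows "summable b" "norm (\<Sum>n. b n) \<le> L * C"
proof -
  have sn: "summable (\<lambda>n. norm (b n))"
    by (rule summable_comparison_test'[OF summable_mult[OF sum, of L]]) (simp add: b)
  then show "summable b" by (rule summable_norm_cancel)
  have "norm (\<Sum>n. b n) \<le> (\<Sum>n. norm (b n))" by (rule summable_norm[OF sn])
  also have "\<dots> \<le> (\<Sum>n. L * (L1norm M (s n) * L1norm M (t n)))"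
    by (rule suminf_le[OF b sn summable_mult[OF sum]])
  also have "\<dots> \<le> L * C" using C L by (simp add: suminf_mult[OF sum] mult_left_mono)
  finally show "norm (\<Sum>n. b n) \<le> L * C" .
qed

lemma not_bounded_approx_diagonal:
  assumes F: "F \<noteq> bot"
  shows "\<not> bounded_approx_diagonal M F u v w"
proof
  assume bad: "bounded_approx_diagonal M F u v w"
  then have uv: "u i n \<in> ZL1 M" "v i n \<in> ZL1 M" for i n
    by (simp_all add: bounded_approx_diagonal_def)
  from bad have "\<exists>C. \<forall>i. summable (\<lambda>n. L1norm M (u i n) * L1norm M (v i n)) \<and>
      (\<Sum>n. L1norm M (u i n) * L1norm M (v i n)) \<le> C"
    unfolding bounded_approx_diagonal_def by (elim conjE)
  then obtain C where sum: "summable (\<lambda>n. L1norm M (u i n) * L1norm M (v i n))"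
    and C: "(\<Sum>n. L1norm M (u i n) * L1norm M (v i n)) \<le> C" for i
    by blast
  from bad have w: "w i \<in> ZL1 M"
    and w_lim: "(\<lambda>N. L1norm M (\<lambda>x. (\<Sum>n<N. conv M (u i n) (v i n) x) - w i x)) \<longlonglongrightarrow> 0" for i
    by (simp_all add: bounded_approx_diagonal_def)
  from bad have unit: "((\<lambda>i. L1norm M (\<lambda>x. conv M (w i) a x - a x)) \<longlongrightarrow> 0) F"
    and diag: "((\<lambda>i. proj_norm M (\<lambda>B. (\<Sum>n. B (conv M a (u i n)) (v i n))
                                 - (\<Sum>n. B (u i n) (conv M (v i n) a)))) \<longlongrightarrow> 0) F"
    if "a \<in> ZL1 M" for a
    using that by (simp_all add: bounded_approx_diagonal_def)
  have uvi: "integrable M (u i n)" "integrable M (v i n)" for i n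
    using uv by (simp_all add: ZL1_integrable)
  \<comment> \<open>The pairing of the \<open>i\<close>-th element of the net with the tensor
    product of \<open>sph k\<close> and \<open>sph l\<close>.\<close>
  define E where "E k l i = (\<Sum>n. Phi k (u i n) * Phi l (v i n))" for k l i
  have summable_B: "summable (\<lambda>n. B (u i n) (v i n))"
    and bound_B: "norm (\<Sum>n. B (u i n) (v i n)) \<le> C" if "B \<in> bilin1 M" for B i
    using series_bound[OF sum[of i] C[of i], of 1 "\<lambda>n. B (u i n) (v i n)"] bilin1_bound[OF that uv] by simp_all
  note summable_E = summable_B[OF Phi_tensor_bilin1]

  \<comment> \<open>Since \<open>Phi k\<close> is multiplicative, applying it to the product map
    amounts to pairing with \<open>sph k\<close> in both legs.\<close>
  have Phi_w: "Phi k (w i) = E k k i" for k i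
  proof -
    have "(\<lambda>N. (\<Sum>n<N. Phi k (u i n) * Phi k (v i n)) - Phi k (w i)) \<longlonglongrightarrow> 0"
    proof (rule Lim_null_comparison[OF _ w_lim])
      have int: "integrable M (\<lambda>x. \<Sum>n<N. conv M (u i n) (v i n) x)" for N
        by (intro Bochner_Integration.integrable_sum integrable_conv uvi)
      have "(\<Sum>n<N. Phi k (u i n) * Phi k (v i n)) - Phi k (w i)
          = Phi k (\<lambda>x. (\<Sum>n<N. conv M (u i n) (v i n) x) - w i x)" for N
        by (simp add: Phi_diff[OF int ZL1_integrable[OF w]] Phi_sum integrable_conv uvi Phi_conv uv)
      then show "\<forall>\<^sub>F N in sequentially. norm ((\<Sum>n<N. Phi k (u i n) * Phi k (v i n)) - Phi k (w i))
          \<le> L1norm M (\<lambda>x. (\<Sum>n<N. conv M (u i n) (v i n) x) - w i x)"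
        using norm_Phi_le[OF Bochner_Integration.integrable_diff[OF int ZL1_integrable[OF w]]] by simp
    qed
    then have "(\<lambda>n. Phi k (u i n) * Phi k (v i n)) sums Phi k (w i)"
      unfolding sums_def by (simp add: LIM_zero_iff)
    then show ?thesis unfolding E_def by (rule sums_unique)
  qed

  \<comment> \<open>\<open>Phi k\<close> applied to \<open>conv M (w i) a - a\<close> gives
    \<open>(E k k i - 1) * Phi k a\<close>; choose \<open>a\<close> with \<open>Phi k a\<close>
    nonzero and divide.\<close>
  have E_diag: "(E k k \<longlongrightarrow> 1) F" for k
  proof -
    obtain a where a: "a \<in> ZL1 M" "Phi k a \<noteq> 0" using ex_Phi_neq_0 by blast
    note ai = ZL1_integrable[OF a(1)] and wi = ZL1_integrable[OF w]
    have "((\<lambda>i. (E k k i - 1) * Phi k a) \<longlongrightarrow> 0) F"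
    proof (rule Lim_null_comparison[OF _ unit[OF a(1)]])
      have "norm ((E k k i - 1) * Phi k a) \<le> L1norm M (\<lambda>x. conv M (w i) a x - a x)" for i
        using norm_Phi_le[OF Bochner_Integration.integrable_diff[OF integrable_conv[OF wi ai] ai]]
        by (simp add: Phi_diff integrable_conv wi ai Phi_conv w Phi_w left_diff_distrib)
      then show "\<forall>\<^sub>F i in F. norm ((E k k i - 1) * Phi k a) \<le> L1norm M (\<lambda>x. conv M (w i) a x - a x)"
        by simp
    qed
    from tendsto_mult_right[OF this, of "inverse (Phi k a)"] a(2)
    have "((\<lambda>i. E k k i - 1) \<longlongrightarrow> 0) F" by (simp add: mult.assoc)
    then show ?thesis by (rule LIM_zero_cancel)
  qed

  \<comment> \<open>Pairing the commutator of \<open>a\<close> with the net gives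
    \<open>(Phi k a - Phi l a) * E k l i\<close>; divide by the nonzero difference.\<close>
  have E_off: "(E k l \<longlongrightarrow> 0) F" if a: "a \<in> ZL1 M" and neq: "Phi k a \<noteq> Phi l a" for k l a
  proof -
    note ai = ZL1_integrable[OF a]
    define X where "X i B = (\<Sum>n. B (conv M a (u i n)) (v i n)) - (\<Sum>n. B (u i n) (conv M (v i n) a))"
      for i and B :: "fn \<Rightarrow> fn \<Rightarrow> complex"
    \<comment> \<open>A real supremum dominates its members only if the set is bounded above; this
      is needed before \<open>proj_norm\<close> can bound the value at a single form.\<close>
    have X_bound: "norm (X i B) \<le> 2 * (L1norm M a * C)" if B: "B \<in> bilin1 M" for i B
    proof -
      have "norm (B (conv M a (u i n)) (v i n)) \<le> L1norm M a * (L1norm M (u i n) * L1norm M (v i n))" for n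
        using bilin1_bound[OF B ZL1_conv[OF a uv(1)[where i=i and n=n]] uv(2)[where i=i and n=n]]
          mult_right_mono[OF L1norm_conv_le[OF ai uvi(1)[where i=i and n=n]] L1norm_nonneg[of "v i n"]]
        by (simp add: mult.assoc)
      from series_bound(2)[OF sum C L1norm_nonneg this]
      have 1: "norm (\<Sum>n. B (conv M a (u i n)) (v i n)) \<le> L1norm M a * C" .
      have "norm (B (u i n) (conv M (v i n) a)) \<le> L1norm M a * (L1norm M (u i n) * L1norm M (v i n))" for n
        using bilin1_bound[OF B uv(1)[where i=i and n=n] ZL1_conv[OF uv(2)[where i=i and n=n] a]]
          mult_left_mono[OF L1norm_conv_le[OF uvi(2)[where i=i and n=n] ai] L1norm_nonneg[of "u i n"]]
        by (simp add: mult_ac)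
      from series_bound(2)[OF sum C L1norm_nonneg this]
      have 2: "norm (\<Sum>n. B (u i n) (conv M (v i n) a)) \<le> L1norm M a * C" .
      show ?thesis
        unfolding X_def using norm_triangle_ineq4[of "\<Sum>n. B (conv M a (u i n)) (v i n)" "\<Sum>n. B (u i n) (conv M (v i n) a)"] 1 2
        by linarith
    qed
    have "((\<lambda>i. (Phi k a - Phi l a) * E k l i) \<longlongrightarrow> 0) F"
    proof (rule Lim_null_comparison[OF _ diag[OF a]])
      have "norm ((Phi k a - Phi l a) * E k l i) \<le> proj_norm M (X i)" for i
      proof -
        have "X i (\<lambda>f g. Phi k f * Phi l g) = (Phi k a - Phi l a) * E k l i"
          using suminf_mult[OF summable_E[of k i l], of "Phi k a"] suminf_mult[OF summable_E[of k i l], of "Phi l a"]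
          by (simp add: X_def E_def Phi_conv a ai uv uvi left_diff_distrib mult_ac)
        moreover have "bdd_above ((\<lambda>B. norm (X i B)) ` bilin1 M)"
          using X_bound by (intro bdd_aboveI2)
        ultimately show ?thesis
          unfolding proj_norm_def using cSUP_upper[OF Phi_tensor_bilin1] by metis
      qed
      then show "\<forall>\<^sub>F i in F. norm ((Phi k a - Phi l a) * E k l i)
          \<le> proj_norm M (\<lambda>B. (\<Sum>n. B (conv M a (u i n)) (v i n)) - (\<Sum>n. B (u i n) (conv M (v i n) a)))"
        unfolding X_def by simp
    qed
    from tendsto_mult_left[OF this, of "inverse (Phi k a - Phi l a)"] neq show ?thesis
      by (simp flip: mult.assoc)
  qed
  note E_off1 = E_off[OF psi_in_ZL1 Phi_psi_neq] and E_off2 = E_off[OF psi_in_ZL1 Phi_psi_neq[symmetric]]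

  have "real K \<le> C" for K
  proof -
    \<comment> \<open>The pairing with the sum of \<open>psi k / 2\<close> tensor
      \<open>psi k\<close>, expanded; every summand tends to \<open>(1 - 0 - 0 + 1) / 2 = 1\<close>,
      so \<open>D\<close> tends to \<open>K\<close>, while the norm of the form is at most
      1.\<close>
    define D where "D i = (\<Sum>k<K. (E k k i - E k (Suc k) i - E (Suc k) k i + E (Suc k) (Suc k) i) / 2)" for i
    have "D i = (\<Sum>n. \<Sum>k<K. (\<integral>x. u i n x * (psi k x / 2) \<partial>M) * (\<integral>y. v i n y * psi k y \<partial>M))" for i
    proof -
      have "(\<integral>x. u i n x * (psi k x / 2) \<partial>M) * (\<integral>y. v i n y * psi k y \<partial>M)
        = (Phi k (u i n) * Phi k (v i n) - Phi k (u i n) * Phi (Suc k) (v i n)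
          - Phi (Suc k) (u i n) * Phi k (v i n) + Phi (Suc k) (u i n) * Phi (Suc k) (v i n)) / 2" for n k
        by (simp add: integral_mult_psi uvi) (simp add: algebra_simps)
      moreover have "(\<lambda>n. \<Sum>k<K. (Phi k (u i n) * Phi k (v i n) - Phi k (u i n) * Phi (Suc k) (v i n)
          - Phi (Suc k) (u i n) * Phi k (v i n) + Phi (Suc k) (u i n) * Phi (Suc k) (v i n)) / 2) sums D i"
        unfolding D_def E_def
        by (intro sums_sum sums_divide sums_add sums_diff summable_sums summable_E)
      ultimately show ?thesis by (simp add: sums_unique)
    qed
    then have "norm (D i) \<le> C" for i
      using bound_B[OF psi_tensor_bilin1] by simp
    moreover have "(D \<longlongrightarrow> (\<Sum>k<K. (1 - 0 - 0 + 1) / 2)) F"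
      unfolding D_def [abs_def] by (intro tendsto_intros E_diag E_off1 E_off2) simp
    then have "((\<lambda>i. norm (D i)) \<longlongrightarrow> real K) F"
      using tendsto_norm by fastforce
    \<comment> \<open>The bound \<open>C\<close> passes to the limit because \<open>F\<close> is a
      proper filter.\<close>
    ultimately show ?thesis
      using tendsto_upperbound[OF _ _ F] by (metis (no_types, lifting) always_eventually)
  qed
  then show False using reals_Archimedean2[of C] by (meson not_less)
qed

end

theorem theorem1p12:
  fixes M :: "mat2 measure"
  assumes "haar_SU2 M"
  shows "\<not> (\<exists>(F :: 'i filter) u v w. F \<noteq> bot \<and> bounded_approx_diagonal M F u v w)"
proof -
  interpret haar M by standard (rule assms)
  show ?thesis using not_bounded_approx_diagonal by blast
qed

end
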